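(* For a graph $G$, its triangle graph $\mathcal{T}(G)$ is chordal if and only if $G$ does not contain a (not necessarily induced) subgraph which is isomorphic to any of the following graphs: (a) $W_n$, for $n\ge 4$; (b) $C_n^2$, for $n\ge 5$; (c) $K_6-K_3$; (d) $K_6-P_4$; (e) graphs obtained from any graphs described in (b)–(d) by any number of weak edge splittings and weak vertex stickings.
   Context: All graphs are finite, simple and undirected. A graph is chordal if it contains no induced $n$-cycle with $n\ge 4$. A triangle is a $K_3$ subgraph. The triangle graph $\mathcal{T}(G)$ of $G$ has one vertex for each triangle of $G$, two vertices being adjacent if and only if the corresponding triangles share an edge. $W_n=K_1\vee C_n$ is the $n$-wheel. $C_m^2$ is the square of the $m$-cycle (vertices adjacent iff at distance $1$ or $2$ in $C_m$). $K_n-F$ is the graph obtained from $K_n$ by deleting the edge set of a subgraph isomorphic to $F$; $P_4$ is the path on 4 vertices. The weak operations are applied to a graph $H$ together with a specified induced cycle of $\mathcal{T}(H)$ which does not consist of three triangles of $H$ sharing a common edge. The triangles of $H$ corresponding to the vertices of this cycle are called cycle-triangles; an edge is private if it belongs to exactly one cycle-triangle. The starting graphs $C_m^2$, $K_6-K_3$, $K_6-P_4$ are taken with a specified induced cycle in their triangle graph of length $m$, $6$, $6$, respectively. Weak edge splitting: for a private edge $e=uv$ belonging to the cycle-triangle $uvx$, delete the edge $uv$, introduce a new vertex $w$ and add the edges $uw,wv,wx$. In the specified cycle, the triangle $uvx$ is replaced by the two consecutive triangles $uwx$, $wvx$, giving the specified cycle (one longer) of the new graph. Weak vertex sticking: for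 two vertices $u,v$ at distance at least $3$ apart, remove $u$ and $v$ and introduce a new vertex $w$ adjacent to all of $N(u)\cup N(v)$, where $N(\cdot)$ is the open neighborhood. The specified cycle is kept, with $u$ and $v$ replaced by $w$ in the cycle-triangles. *)

theory Defs
  imports Main "HOL-Library.Extended_Nat"
begin

section \<open>Finite simple undirected graphs\<close>

type_synonym 'a ugraph = "'a set \<times> 'a set set"

abbreviation verts :: "'a ugraph \<Rightarrow> 'a set" where
  "verts G \<equiv> fst G"

abbreviation edges :: "'a ugraph \<Rightarrow> 'a set set" where
  "edges G \<equiv> snd G"

definition simple_graph :: "'a ugraph \<Rightarrow> bool" where
  "simple_graph G \<longleftrightarrow> finite (verts G) \<and> (\<forall>e\<in>edges G. e \<subseteq> verts G \<and> card e = 2)"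

definition subgraph :: "'a ugraph \<Rightarrow> 'a ugraph \<Rightarrow> bool" where
  "subgraph H G \<longleftrightarrow> simple_graph H \<and> verts H \<subseteq> verts G \<and> edges H \<subseteq> edges G"

definition graph_iso :: "'a ugraph \<Rightarrow> 'b ugraph \<Rightarrow> bool" where
  "graph_iso G H \<longleftrightarrow> (\<exists>f. bij_betw f (verts G) (verts H) \<and> edges H = (\<lambda>e. f ` e) ` edges G)"

definition contains_copy :: "'a ugraph \<Rightarrow> 'b ugraph \<Rightarrow> bool" where
  "contains_copy G H \<longleftrightarrow> (\<exists>S. subgraph S G \<and> graph_iso S H)"

definition neighborhood :: "'a ugraph \<Rightarrow> 'a \<Rightarrow> 'a set" where
  "neighborhood G v = {y \<in> verts G. {v, y} \<in> edges G}"

definition walk :: "'a ugraph \<Rightarrow> 'a \<Rightarrow> 'a list \<Rightarrow> 'a \<Rightarrow> bool" where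
  "walk G u p v \<longleftrightarrow> p \<noteq> [] \<and> hd p = u \<and> last p = v \<and> set p \<subseteq> verts G \<and>
     (\<forall>i. i + 1 < length p \<longrightarrow> {p ! i, p ! (i + 1)} \<in> edges G)"

text \<open>The infimum of the empty set is \<open>\<infinity>\<close>, so vertices in different components are at
  infinite distance.\<close>

definition gdist :: "'a ugraph \<Rightarrow> 'a \<Rightarrow> 'a \<Rightarrow> enat" where
  "gdist G u v = (INF p \<in> {p. walk G u p v}. enat (length p - 1))"

text \<open>An induced cycle is given by the cyclic sequence of its vertices.\<close>

definition induced_cycle :: "'a ugraph \<Rightarrow> 'a list \<Rightarrow> bool" where
  "induced_cycle G c \<longleftrightarrow> 3 \<le> length c \<and> distinct c \<and> set c \<subseteq> verts G \<and>
     (\<forall>i<length c. \<forall>j<length c. {c ! i, c ! j} \<in> edges G \<longleftrightarrow>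
        j = (i + 1) mod length c \<or> i = (j + 1) mod length c)"

definition chordal :: "'a ugraph \<Rightarrow> bool" where
  "chordal G \<longleftrightarrow> \<not> (\<exists>c. induced_cycle G c \<and> 4 \<le> length c)"


section \<open>The triangle graph\<close>

text \<open>A triangle is identified with its set of three vertices.\<close>

definition triangles :: "'a ugraph \<Rightarrow> 'a set set" where
  "triangles G = {T. T \<subseteq> verts G \<and> card T = 3 \<and> (\<forall>x\<in>T. \<forall>y\<in>T. x \<noteq> y \<longrightarrow> {x, y} \<in> edges G)}"

definition triangle_graph :: "'a ugraph \<Rightarrow> 'a set ugraph" where
  "triangle_graph G =
     (triangles G,
      {{S, T} | S T. S \<in> triangles G \<and> T \<in> triangles G \<and> S \<noteq> T \<and>
                     (\<exists>e\<in>edges G. e \<subseteq> S \<and> e \<subseteq> T)})"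


section \<open>Particular graphs\<close>

definition complete_graph :: "'a set \<Rightarrow> 'a ugraph" where
  "complete_graph A = (A, {e. e \<subseteq> A \<and> card e = 2})"

text \<open>Meant for \<open>n \<ge> 3\<close>.\<close>

definition cycle_graph :: "nat \<Rightarrow> nat ugraph" where
  "cycle_graph n = ({..<n}, {{i, (i + 1) mod n} | i. i < n})"

definition path_graph :: "nat \<Rightarrow> nat ugraph" where
  "path_graph n = ({..<n}, {{i, i + 1} | i. i + 1 < n})"

text \<open>Meant for graphs with disjoint vertex sets.\<close>

definition graph_join :: "'a ugraph \<Rightarrow> 'a ugraph \<Rightarrow> 'a ugraph" where
  "graph_join G H =
     (verts G \<union> verts H,
      edges G \<union> edges H \<union> {{u, v} | u v. u \<in> verts G \<and> v \<in> verts H})"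

definition wheel :: "nat \<Rightarrow> nat ugraph" where
  "wheel n = graph_join (complete_graph {n}) (cycle_graph n)"

definition graph_square :: "'a ugraph \<Rightarrow> 'a ugraph" where
  "graph_square G =
     (verts G,
      {{u, v} | u v. u \<in> verts G \<and> v \<in> verts G \<and> (gdist G u v = 1 \<or> gdist G u v = 2)})"

definition delete_edges :: "'a ugraph \<Rightarrow> 'a set set \<Rightarrow> 'a ugraph" where
  "delete_edges G F = (verts G, edges G - F)"

definition K6_minus_K3 :: "nat ugraph" where
  "K6_minus_K3 = delete_edges (complete_graph {..<6}) (edges (complete_graph {..<3}))"

definition K6_minus_P4 :: "nat ugraph" where
  "K6_minus_P4 = delete_edges (complete_graph {..<6}) (edges (path_graph 4))"


section \<open>Weak operations\<close>

definition specified_cycle :: "'a ugraph \<Rightarrow> 'a set list \<Rightarrow> bool" where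
  "specified_cycle H c \<longleftrightarrow> induced_cycle (triangle_graph H) c \<and>
     \<not> (length c = 3 \<and> (\<exists>e\<in>edges H. \<forall>T\<in>set c. e \<subseteq> T))"

definition private_edge :: "'a ugraph \<Rightarrow> 'a set list \<Rightarrow> 'a set \<Rightarrow> bool" where
  "private_edge H c e \<longleftrightarrow> e \<in> edges H \<and> (\<exists>!T. T \<in> set c \<and> e \<subseteq> T)"

text \<open>Since \<open>u\<close> and \<open>v\<close> are interchangeable, the two new triangles can be inserted into the cyclic
  sequence in either order; requiring the result to be an induced cycle of the new triangle graph
  selects the correct one.\<close>

definition weak_edge_splitting ::
  "'a ugraph \<Rightarrow> 'a set list \<Rightarrow> 'a ugraph \<Rightarrow> 'a set list \<Rightarrow> bool" where
  "weak_edge_splitting H c H' c' \<longleftrightarrow>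
     specified_cycle H c \<and> specified_cycle H' c' \<and>
     (\<exists>u v x w ts us.
        private_edge H c {u, v} \<and> w \<notin> verts H \<and>
        H' = (insert w (verts H), (edges H - {{u, v}}) \<union> {{u, w}, {w, v}, {w, x}}) \<and>
        c = ts @ [{u, v, x}] @ us \<and>
        c' = ts @ [{u, w, x}, {w, v, x}] @ us)"

definition weak_vertex_sticking ::
  "'a ugraph \<Rightarrow> 'a set list \<Rightarrow> 'a ugraph \<Rightarrow> 'a set list \<Rightarrow> bool" where
  "weak_vertex_sticking H c H' c' \<longleftrightarrow>
     specified_cycle H c \<and>
     (\<exists>u v w.
        u \<in> verts H \<and> v \<in> verts H \<and> 3 \<le> gdist H u v \<and> w \<notin> verts H \<and>
        H' = (insert w (verts H - {u, v}),
              {e \<in> edges H. u \<notin> e \<and> v \<notin> e} \<union>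
              {{w, y} | y. y \<in> neighborhood H u \<union> neighborhood H v}) \<and>
        c' = map (\<lambda>T. (\<lambda>y. if y = u \<or> y = v then w else y) ` T) c)"

text \<open>Vertices are natural numbers, so that every finite graph has a copy and fresh vertices are
  always available.\<close>

inductive weakly_generated :: "nat ugraph \<Rightarrow> nat set list \<Rightarrow> bool" where
  cycle_square:
    "\<lbrakk>5 \<le> m; induced_cycle (triangle_graph (graph_square (cycle_graph m))) c; length c = m\<rbrakk>
     \<Longrightarrow> weakly_generated (graph_square (cycle_graph m)) c"
| K6_minus_K3:
    "\<lbrakk>induced_cycle (triangle_graph K6_minus_K3) c; length c = 6\<rbrakk>
     \<Longrightarrow> weakly_generated K6_minus_K3 c"
| K6_minus_P4:
    "\<lbrakk>induced_cycle (triangle_graph K6_minus_P4) c; length c = 6\<rbrakk>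
     \<Longrightarrow> weakly_generated K6_minus_P4 c"
| splitting:
    "\<lbrakk>weakly_generated H c; weak_edge_splitting H c H' c'\<rbrakk> \<Longrightarrow> weakly_generated H' c'"
| sticking:
    "\<lbrakk>weakly_generated H c; weak_vertex_sticking H c H' c'\<rbrakk> \<Longrightarrow> weakly_generated H' c'"

end

theory Submission
  imports Defs
begin

text \<open>Let \<open>T\<^sub>0, \<dots>, T\<^sub>n\<^sub>-\<^sub>1\<close> with \<open>n \<ge> 4\<close> be an induced cycle of the triangle graph. Consecutive triangles share
  an edge, the two edges that a triangle shares with its neighbours are different, and so they meet in
  a vertex, its apex. The cycle is therefore a closed strip of triangles: each triangle is an
  oriented triple \<open>(x, u, v)\<close>, entered through \<open>xu\<close> and left through \<open>xv\<close>. From one triangle to the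
  next either the apex stays, or the strip turns: the vertex opposite to the apex on the common edge
  becomes the new apex, and the old apex becomes opposite to it. Without a turn, all triangles surround one
  vertex and form a wheel. Otherwise the strip is a cyclic sequence of \<open>k\<close> runs, the triangles of a run
  being a fan around their apex.
  
  Consider the strip with all vertices that are not forced to coincide taken to be different, as an
  abstract graph. Inserting a rim vertex into a fan is exactly a weak edge splitting, so the abstract
  strip arises by splittings from any strip with the same turns and shorter runs. For
  \<open>k \<ge> 5\<close> all runs can be shortened to one triangle, which leaves \<open>C\<^sub>k\<^sup>2\<close>. For smaller \<open>k\<close> the strip would
  then no longer be an induced cycle, and the fact that an edge lies in at most two triangles of the cycle
  says how long the runs must be: \<open>k \<le> 2\<close> is impossible; for \<open>k = 3\<close> every run has two triangles or more,
  which leads to \<open>K\<^sub>6 - K\<^sub>3\<close>; for \<open>k = 4\<close> two runs that follow each other have two triangles or more,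
  which leads to \<open>K\<^sub>6 - P\<^sub>4\<close>.
  
  It remains to pass from the abstract strip to the actual one, in which vertices may coincide. The map
  between them is injective on edges, since an edge determines its place in the cycle. Hence two
  vertices with the same image are at distance at least 3: at distance 1 their edge would collapse, at distance 2
  two edges would be merged. They can thus be stuck together, one pair after the other, until
  the map is injective and exhibits a copy of a weakly generated graph.
  
  Conversely, both operations keep the specified cycle an induced cycle in the triangle graph, of length at
  least 5, and a copy of \<open>H\<close> in \<open>G\<close> turns an induced cycle of the triangle graph of \<open>H\<close> into one of the
  triangle graph of \<open>G\<close>, because two triangles share an edge if and only if they share two vertices.
  
  The construction is carried by \<open>tri_cycle_closed_strip\<close> (the strip), \<open>wheel_copy_from_strip\<close> (no turn),
  \<open>liftable_split\<close> (splitting), \<open>liftable_turning_strip\<close> (the case distinction on \<open>k\<close>),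
  \<open>relabel_edge_embedding\<close> and \<open>weakly_generated_copy_from_edge_embedding\<close> (sticking), the converse by
  \<open>weakly_generated_invariant\<close> and \<open>contains_copy_not_chordal\<close>.\<close>

section \<open>Cycles of triangles\<close>

text \<open>An induced cycle of a triangle graph, expressed by the vertex sets alone: within a simple graph, two
  different triangles share an edge if and only if they share two vertices. As the graph is
  not mentioned, a cycle can be compared between different graphs.\<close>

definition tri_cycle :: "'a set list \<Rightarrow> bool" where
  "tri_cycle c \<longleftrightarrow> 3 \<le> length c \<and> distinct c \<and> (\<forall>T\<in>set c. card T = 3) \<and>
     (\<forall>i<length c. \<forall>j<length c. i \<noteq> j \<longrightarrow>
        (2 \<le> card (c ! i \<inter> c ! j) \<longleftrightarrow> j = (i + 1) mod length c \<or> i = (j + 1) mod length c))"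

lemma two_le_card_iff:
  assumes "finite A"
  shows "2 \<le> card A \<longleftrightarrow> (\<exists>a b. a \<noteq> b \<and> a \<in> A \<and> b \<in> A)"
proof
  assume "2 \<le> card A"
  then obtain B where "B \<subseteq> A" "card B = 2" by (meson obtain_subset_with_card_n)
  then show "\<exists>a b. a \<noteq> b \<and> a \<in> A \<and> b \<in> A" by (auto simp: card_2_iff)
next
  assume "\<exists>a b. a \<noteq> b \<and> a \<in> A \<and> b \<in> A"
  then obtain a b where "a \<noteq> b" "{a, b} \<subseteq> A" by blast
  then show "2 \<le> card A" using card_mono[OF assms, of "{a, b}"] by simp
qed

lemma two_le_cardI: "finite A \<Longrightarrow> {a, b} \<subseteq> A \<Longrightarrow> a \<noteq> b \<Longrightarrow> 2 \<le> card A"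
  using two_le_card_iff[of A] by blast

lemma triangles_card: "T \<in> triangles G \<Longrightarrow> card T = 3 \<and> finite T \<and> T \<subseteq> verts G"
  by (auto simp: triangles_def intro: card_ge_0_finite)

lemma triangle_edge: "T \<in> triangles G \<Longrightarrow> a \<in> T \<Longrightarrow> b \<in> T \<Longrightarrow> a \<noteq> b \<Longrightarrow> {a, b} \<in> edges G"
  by (simp add: triangles_def)

lemma triangle_graph_edge_iff:
  assumes "simple_graph G" "S \<in> triangles G" "T \<in> triangles G"
  shows "{S, T} \<in> edges (triangle_graph G) \<longleftrightarrow> S \<noteq> T \<and> 2 \<le> card (S \<inter> T)"
proof
  assume "{S, T} \<in> edges (triangle_graph G)"
  then obtain e where e: "S \<noteq> T" "e \<in> edges G" "e \<subseteq> S" "e \<subseteq> T"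
    by (auto simp: triangle_graph_def doubleton_eq_iff)
  moreover have "card e = 2" using assms(1) e by (auto simp: simple_graph_def)
  ultimately show "S \<noteq> T \<and> 2 \<le> card (S \<inter> T)"
    using card_mono[of "S \<inter> T" e] triangles_card[OF assms(2)] by simp
next
  assume *: "S \<noteq> T \<and> 2 \<le> card (S \<inter> T)"
  then obtain a b where ab: "a \<noteq> b" "{a, b} \<subseteq> S" "{a, b} \<subseteq> T"
    using two_le_card_iff[of "S \<inter> T"] triangles_card[OF assms(2)] by auto
  then have "{a, b} \<in> edges G" using triangle_edge[OF assms(2)] by simp
  then have "\<exists>e\<in>edges G. e \<subseteq> S \<and> e \<subseteq> T" using ab by blast
  then show "{S, T} \<in> edges (triangle_graph G)"
    using * assms unfolding triangle_graph_def snd_conv mem_Collect_eq by blast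
qed

lemma induced_cycle_triangle_graph_iff:
  assumes "simple_graph G"
  shows "induced_cycle (triangle_graph G) c \<longleftrightarrow> set c \<subseteq> triangles G \<and> tri_cycle c"
proof (cases "3 \<le> length c \<and> distinct c \<and> set c \<subseteq> triangles G")
  case True
  then have len: "3 \<le> length c" and dis: "distinct c" and sub: "set c \<subseteq> triangles G" by auto
  \<comment> \<open>The two conditions treat \<open>i = j\<close> differently: here no cyclic successor may be a fixed point.\<close>
  have loop: "i \<noteq> (i + 1) mod length c" if "i < length c" for i
    using that len by (auto simp: mod_Suc)
  have pair: "{c ! i, c ! j} \<in> edges (triangle_graph G) \<longleftrightarrow> i \<noteq> j \<and> 2 \<le> card (c ! i \<inter> c ! j)"
    if "i < length c" "j < length c" for i j
  proof -
    have "c ! i \<in> triangles G" "c ! j \<in> triangles G" using that sub by (auto dest: nth_mem)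
    then show ?thesis
      using triangle_graph_edge_iff[OF assms] that dis by (simp add: nth_eq_iff_index_eq)
  qed
  have "verts (triangle_graph G) = triangles G" by (simp add: triangle_graph_def)
  moreover have "\<forall>T\<in>set c. card T = 3" using sub triangles_card by blast
  moreover have "({c ! i, c ! j} \<in> edges (triangle_graph G) \<longleftrightarrow>
        j = (i + 1) mod length c \<or> i = (j + 1) mod length c) \<longleftrightarrow>
      (i \<noteq> j \<longrightarrow> (2 \<le> card (c ! i \<inter> c ! j) \<longleftrightarrow>
        j = (i + 1) mod length c \<or> i = (j + 1) mod length c))"
    if "i < length c" "j < length c" for i j
    using pair[OF that] loop[of i] that by (cases "i = j") simp_all
  ultimately show ?thesis
    unfolding induced_cycle_def tri_cycle_def using True by simp
next
  case False
  then show ?thesis by (auto simp: induced_cycle_def tri_cycle_def triangle_graph_def)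
qed

lemma tri_cycle_rotate1:
  assumes "tri_cycle c"
  shows "tri_cycle (rotate1 c)"
proof -
  let ?n = "length c"
  have n: "3 \<le> ?n" using assms by (simp add: tri_cycle_def)
  have "2 \<le> card (rotate1 c ! i \<inter> rotate1 c ! j) \<longleftrightarrow>
      j = (i + 1) mod ?n \<or> i = (j + 1) mod ?n" if "i < ?n" "j < ?n" "i \<noteq> j" for i j
  proof -
    have "Suc i mod ?n \<noteq> Suc j mod ?n" using that by (auto simp: mod_Suc split: if_splits)
    moreover have "Suc i mod ?n < ?n" "Suc j mod ?n < ?n" using n by (auto intro!: mod_less_divisor)
    ultimately have "2 \<le> card (rotate1 c ! i \<inter> rotate1 c ! j) \<longleftrightarrow>
        Suc j mod ?n = (Suc i mod ?n + 1) mod ?n \<or> Suc i mod ?n = (Suc j mod ?n + 1) mod ?n"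
      using assms that by (auto simp: tri_cycle_def nth_rotate1)
    also have "\<dots> \<longleftrightarrow> j = (i + 1) mod ?n \<or> i = (j + 1) mod ?n"
      using that n by (auto simp: mod_Suc)
    finally show ?thesis .
  qed
  then show ?thesis using assms by (auto simp: tri_cycle_def)
qed

text \<open>The start of the sequence is arbitrary; arguments about one place of the cycle move this place to
  the end of the list, where no index wraps around.\<close>

lemma tri_cycle_append_swap: "tri_cycle (A @ B) \<Longrightarrow> tri_cycle (B @ A)"
proof -
  assume *: "tri_cycle (A @ B)"
  have "tri_cycle (rotate m c)" if "tri_cycle c" for m and c :: "'a set list"
    using that by (induction m) (auto intro: tri_cycle_rotate1)
  from this[OF *, of "length A"] show ?thesis by (simp add: rotate_append)
qed

lemma Suc_mod_inj: "Suc i mod n = Suc j mod n \<Longrightarrow> i < n \<Longrightarrow> j < n \<Longrightarrow> i = j"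
  by (auto simp: mod_Suc split: if_splits)

text \<open>Of three neighbours in a cycle, two would both be successors or both be predecessors, and the cyclic
  successor of an index is injective.\<close>

lemma tri_cycle_three_neighbours:
  assumes "tri_cycle c" "{S, A, B, C} \<subseteq> set c" "distinct [S, A, B, C]"
    "2 \<le> card (S \<inter> A)" "2 \<le> card (S \<inter> B)" "2 \<le> card (S \<inter> C)"
  shows False
proof -
  obtain i j k l where idx: "i < length c" "c ! i = S" "j < length c" "c ! j = A"
    "k < length c" "c ! k = B" "l < length c" "c ! l = C"
    using assms(2) by (auto simp: in_set_conv_nth)
  then have ne: "i \<noteq> j" "i \<noteq> k" "i \<noteq> l" "j \<noteq> k" "j \<noteq> l" "k \<noteq> l" using assms(3) by auto
  have *: "q = Suc i mod length c \<or> i = Suc q mod length c"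
    if "q < length c" "i \<noteq> q" "2 \<le> card (S \<inter> c ! q)" for q
    using assms(1) that idx by (auto simp: tri_cycle_def)
  have "2 \<le> card (S \<inter> c ! j)" "2 \<le> card (S \<inter> c ! k)" "2 \<le> card (S \<inter> c ! l)"
    using assms(4-6) idx by simp_all
  then show False
    using *[OF idx(3) ne(1)] *[OF idx(5) ne(2)] *[OF idx(7) ne(3)] Suc_mod_inj ne idx(3,5,7)
    by metis
qed

text \<open>Triangles on a common edge are pairwise adjacent, and three pairwise adjacent vertices of an induced
  cycle form the whole cycle.\<close>

lemma tri_cycle_common_edge:
  assumes "tri_cycle c" "4 \<le> length c" "{A, B, C} \<subseteq> set c" "distinct [A, B, C]"
    and ab: "a \<noteq> b" "{a, b} \<subseteq> A" "{a, b} \<subseteq> B" "{a, b} \<subseteq> C"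
  shows False
proof -
  obtain j k l where idx: "j < length c" "c ! j = A" "k < length c" "c ! k = B"
    "l < length c" "c ! l = C"
    using assms(3) by (auto simp: in_set_conv_nth)
  then have ne: "j \<noteq> k" "j \<noteq> l" "k \<noteq> l" using assms(4) by auto
  have fin: "finite T" if "T \<in> set c" for T
    using assms(1) that by (auto simp: tri_cycle_def intro: card_ge_0_finite)
  have *: "q = Suc p mod length c \<or> p = Suc q mod length c"
    if "p < length c" "q < length c" "p \<noteq> q" "{a, b} \<subseteq> c ! p" "{a, b} \<subseteq> c ! q" for p q
  proof -
    have "2 \<le> card (c ! p \<inter> c ! q)" using that fin ab by (intro two_le_cardI[of _ a b]) auto
    then show ?thesis using assms(1) that by (auto simp: tri_cycle_def)
  qed
  have "{a, b} \<subseteq> c ! j" "{a, b} \<subseteq> c ! k" "{a, b} \<subseteq> c ! l" using ab idx by simp_all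
  note sub = this
  \<comment> \<open>Three pairwise consecutive indices would return to the start after three steps.\<close>
  have no3: "p \<noteq> Suc (Suc (Suc p mod length c) mod length c) mod length c" if "p < length c" for p
    using that assms(2) by (auto simp: mod_Suc)
  show False
    using *[OF idx(1,3) ne(1) sub(1,2)] *[OF idx(1,5) ne(2) sub(1,3)] *[OF idx(3,5) ne(3) sub(2,3)]
      Suc_mod_inj ne idx(1,3,5) no3 by metis
qed

lemma card_3_sets_eq: "card S = 3 \<Longrightarrow> card T = 3 \<Longrightarrow> S \<subseteq> T \<Longrightarrow> S = T"
  by (metis card_subset_eq card.infinite zero_neq_numeral)

text \<open>Cutting the triangle \<open>uvx\<close> along \<open>wx\<close>. Because \<open>w\<close> is new, the half \<open>uwx\<close> can share
  with an old triangle only the edge \<open>ux\<close>, which lies in the predecessor of \<open>uvx\<close> and in no other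
  triangle except \<open>uvx\<close> itself; likewise \<open>wvx\<close> meets the old triangles only in the edge to the successor.\<close>

lemma tri_cycle_split_last:
  assumes "tri_cycle (zs @ [{u, v, x}])" "3 \<le> length zs"
    and pre: "{u, x} \<subseteq> last zs" and suc: "{v, x} \<subseteq> hd zs"
    and w: "w \<notin> \<Union> (set zs)" "w \<notin> {u, v, x}"
  shows "tri_cycle (zs @ [{u, w, x}, {w, v, x}])"
proof -
  let ?T = "{u, v, x}" and ?A = "{u, w, x}" and ?B = "{w, v, x}" and ?m = "length zs"
  let ?c = "zs @ [?A, ?B]"
  have dis: "distinct zs" "?T \<notin> set zs" and c3: "\<forall>S\<in>set zs. card S = 3" and T3: "card ?T = 3"
    using assms(1) by (auto simp: tri_cycle_def)
  have ne: "u \<noteq> v" "u \<noteq> x" "v \<noteq> x" using T3 by (auto simp: card_insert_if split: if_splits)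
  have adj: "2 \<le> card ((zs @ [?T]) ! i \<inter> (zs @ [?T]) ! j) \<longleftrightarrow>
      j = (i + 1) mod Suc ?m \<or> i = (j + 1) mod Suc ?m" if "i \<le> ?m" "j \<le> ?m" "i \<noteq> j" for i j
    using assms(1) that by (auto simp: tri_cycle_def)
  have zz: "2 \<le> card (zs ! i \<inter> zs ! j) \<longleftrightarrow> j = Suc i \<or> i = Suc j"
    if "i < ?m" "j < ?m" "i \<noteq> j" for i j
    using adj[of i j] that by (auto simp: nth_append)
  have zT: "i = 0 \<or> i = ?m - 1" if "i < ?m" "2 \<le> card (zs ! i \<inter> ?T)" for i
    using adj[of i ?m] that by (auto simp: nth_append mod_Suc split: if_splits)
  have fin: "finite (zs ! i)" if "i < ?m" for i
    using c3 that by (metis card.infinite nth_mem zero_neq_numeral)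
  have first: "hd zs = zs ! 0" and lst: "last zs = zs ! (?m - 1)"
    using assms(2) by (cases zs; auto simp: last_conv_nth hd_conv_nth)+
  have noT: "\<not> ?T \<subseteq> zs ! i" if "i < ?m" for i
    using card_3_sets_eq[OF T3, of "zs ! i"] c3 dis that by (metis nth_mem)
  have wz: "w \<notin> zs ! i" if "i < ?m" for i using w that by (auto dest: nth_mem)
  have side: "{a, b} \<subseteq> zs ! i" if "i < ?m" "2 \<le> card (zs ! i \<inter> {a, w, b})" for i a b
    using that wz[of i] fin[of i] by (auto simp: two_le_card_iff)
  have side2: "2 \<le> card (zs ! i \<inter> Q)" if "i < ?m" "{a, b} \<subseteq> zs ! i" "{a, b} \<subseteq> Q" "a \<noteq> b" for i a b Q
    using that fin[of i] by (intro two_le_cardI[of _ a b]) auto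
  have zA: "2 \<le> card (zs ! i \<inter> ?A) \<longleftrightarrow> i = ?m - 1" if i: "i < ?m" for i
  proof
    assume "2 \<le> card (zs ! i \<inter> ?A)"
    then have ux: "{u, x} \<subseteq> zs ! i" using side i by blast
    then have "i = 0 \<or> i = ?m - 1" using zT[OF i] side2[OF i ux, of ?T] ne by auto
    moreover have "i \<noteq> 0"
    proof
      assume "i = 0"
      then have "?T \<subseteq> zs ! i" using ux suc first by simp
      then show False using noT[OF i] by contradiction
    qed
    ultimately show "i = ?m - 1" by blast
  next
    assume "i = ?m - 1"
    then show "2 \<le> card (zs ! i \<inter> ?A)" using side2[OF i, of u x ?A] pre lst ne by auto
  qed
  have zB: "2 \<le> card (zs ! i \<inter> ?B) \<longleftrightarrow> i = 0" if i: "i < ?m" for i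
  proof
    assume "2 \<le> card (zs ! i \<inter> ?B)"
    then have vx: "{v, x} \<subseteq> zs ! i" using side[of i v x] i by (simp add: insert_commute)
    then have "i = 0 \<or> i = ?m - 1" using zT[OF i] side2[OF i vx, of ?T] ne by auto
    moreover have "i \<noteq> ?m - 1"
    proof
      assume "i = ?m - 1"
      then have "?T \<subseteq> zs ! i" using vx pre lst by simp
      then show False using noT[OF i] by contradiction
    qed
    ultimately show "i = 0" by blast
  next
    assume "i = 0"
    then show "2 \<le> card (zs ! i \<inter> ?B)" using side2[OF i, of v x ?B] suc first ne by auto
  qed
  have AB: "2 \<le> card (?A \<inter> ?B)" using w by (intro two_le_cardI[of _ w x]) auto
  have nth: "?c ! ?m = ?A" "?c ! Suc ?m = ?B" "\<And>i. i < ?m \<Longrightarrow> ?c ! i = zs ! i"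
    by (auto simp: nth_append)
  have "2 \<le> card (?c ! i \<inter> ?c ! j) \<longleftrightarrow> j = (i + 1) mod (?m + 2) \<or> i = (j + 1) mod (?m + 2)"
    if ij: "i < j" "j < ?m + 2" for i j
  proof -
    consider "j < ?m" | "i < ?m" "j = ?m" | "i < ?m" "j = Suc ?m" | "i = ?m" "j = Suc ?m"
      using ij by linarith
    then show ?thesis
    proof cases
      case 1 then show ?thesis using ij zz[of i j] nth by (auto simp: mod_Suc)
    next
      case 2 then show ?thesis using zA[of i] nth by (auto simp: mod_Suc)
    next
      case 3 then show ?thesis using zB[of i] nth by (auto simp: mod_Suc)
    next
      case 4 then show ?thesis using AB nth by (auto simp: mod_Suc)
    qed
  qed
  then have "2 \<le> card (?c ! i \<inter> ?c ! j) \<longleftrightarrow> j = (i + 1) mod (?m + 2) \<or> i = (j + 1) mod (?m + 2)"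
    if "i \<noteq> j" "i < ?m + 2" "j < ?m + 2" for i j
    using that by (metis Int_commute nat_neq_iff)
  moreover have "distinct ?c" using dis w ne by auto
  moreover have "card ?A = 3" "card ?B = 3" using ne w by auto
  ultimately show ?thesis unfolding tri_cycle_def using c3 assms(2) by auto
qed

lemma tri_cycle_split:
  assumes "tri_cycle (ts @ [{u, v, x}] @ us)" "4 \<le> length (ts @ [{u, v, x}] @ us)"
    and "{u, x} \<subseteq> last (us @ ts)" "{v, x} \<subseteq> hd (us @ ts)"
    and "w \<notin> \<Union> (set (ts @ [{u, v, x}] @ us))"
  shows "tri_cycle (ts @ [{u, w, x}, {w, v, x}] @ us)"
proof -
  have "tri_cycle ((us @ ts) @ [{u, v, x}])"
    using tri_cycle_append_swap[of "ts @ [{u, v, x}]" us] assms(1) by simp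
  then have "tri_cycle ((us @ ts) @ [{u, w, x}, {w, v, x}])"
    using assms by (intro tri_cycle_split_last) auto
  then show ?thesis using tri_cycle_append_swap[of us "ts @ [{u, w, x}, {w, v, x}]"] by simp
qed

section \<open>Copies of graphs and short distances\<close>

lemma simple_graph_edgeE:
  assumes "simple_graph G" "e \<in> edges G"
  obtains a b where "e = {a, b}" "a \<noteq> b" "a \<in> verts G" "b \<in> verts G"
  using assms unfolding simple_graph_def by (metis card_2_iff insert_subset)

text \<open>Together with the elimination rule below, this identifies copies with injective graph
  homomorphisms; subgraphs and isomorphisms do not appear outside these two rules.\<close>

lemma contains_copyI:
  assumes "simple_graph H" "inj_on f (verts H)" "f ` verts H \<subseteq> verts G" "(`) f ` edges H \<subseteq> edges G"
  shows "contains_copy G H"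
proof -
  let ?S = "(f ` verts H, (`) f ` edges H)" and ?g = "the_inv_into (verts H) f"
  have sub: "e \<subseteq> verts H" "card e = 2" if "e \<in> edges H" for e
    using assms(1) that by (auto simp: simple_graph_def)
  have "subgraph ?S G"
    using assms sub by (auto simp: subgraph_def simple_graph_def card_image inj_on_subset subset_iff)
  moreover have "?g ` f ` e = e" if "e \<in> edges H" for e
    using sub[OF that] assms(2) by (force simp: the_inv_into_f_f image_iff)
  then have "(\<lambda>e. ?g ` e) ` (`) f ` edges H = edges H" by (force simp: image_iff)
  then have "graph_iso ?S H"
    unfolding graph_iso_def
    using bij_betw_the_inv_into[OF inj_on_imp_bij_betw[OF assms(2)]] by (intro exI[of _ ?g]) simp
  ultimately show ?thesis unfolding contains_copy_def by blast
qed

lemma contains_copyE: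
  assumes "contains_copy G H"
  obtains g where "inj_on g (verts H)" "g ` verts H \<subseteq> verts G" "(`) g ` edges H \<subseteq> edges G"
proof -
  obtain S f where S: "subgraph S G" and f: "bij_betw f (verts S) (verts H)"
    and e: "edges H = (\<lambda>e. f ` e) ` edges S"
    using assms by (auto simp: contains_copy_def graph_iso_def)
  let ?g = "the_inv_into (verts S) f"
  have bij: "bij_betw ?g (verts H) (verts S)" using f by (rule bij_betw_the_inv_into)
  have "?g ` f ` d = d" if "d \<in> edges S" for d
  proof -
    have "d \<subseteq> verts S" using S that by (auto simp: subgraph_def simple_graph_def)
    then show ?thesis using f by (force simp: the_inv_into_f_f bij_betw_def image_iff)
  qed
  then have "(`) ?g ` edges H \<subseteq> edges G" using S by (auto simp: e subgraph_def)
  moreover have "?g ` verts H \<subseteq> verts G" using bij S by (auto simp: bij_betw_def subgraph_def)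
  ultimately show ?thesis using that bij by (auto simp: bij_betw_def)
qed

lemma gdist_less_iff: "gdist G u v < n \<longleftrightarrow> (\<exists>p. walk G u p v \<and> enat (length p - 1) < n)"
  by (auto simp: gdist_def INF_less_iff)

lemma gdist_eq_0_iff:
  assumes "u \<in> verts G"
  shows "gdist G u v = 0 \<longleftrightarrow> u = v"
proof -
  have "gdist G u v = 0 \<longleftrightarrow> gdist G u v < 1"
    by (cases "gdist G u v") (auto simp: one_enat_def zero_enat_def)
  also have "\<dots> \<longleftrightarrow> (\<exists>p. walk G u p v \<and> length p = 1)"
    by (auto simp: gdist_less_iff one_enat_def walk_def Suc_le_eq le_Suc_eq)
  also have "\<dots> \<longleftrightarrow> u = v"
    using assms by (auto simp: walk_def length_Suc_conv intro!: exI[of _ "[u]"])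
  finally show ?thesis .
qed

text \<open>Distance at least 3, the side condition of vertex sticking, means: different, not adjacent,
  and without a common neighbour.\<close>

lemma gdist_less_3_iff:
  assumes "simple_graph G" "u \<in> verts G"
  shows "gdist G u v < 3 \<longleftrightarrow>
    u = v \<or> {u, v} \<in> edges G \<or> (\<exists>z. {u, z} \<in> edges G \<and> {z, v} \<in> edges G)"
proof
  assume "gdist G u v < 3"
  then obtain p where p: "walk G u p v" "length p - 1 < 3"
    unfolding gdist_less_iff by (auto simp: numeral_eq_enat)
  then obtain a q where "p = a # q" by (cases p) (auto simp: walk_def)
  then consider "p = [u]" "u = v" | "p = [u, v]" | z where "p = [u, z, v]"
    using p by (cases q rule: list.exhaust; cases "tl q"; cases "tl (tl q)") (auto simp: walk_def)
  then show "u = v \<or> {u, v} \<in> edges G \<or> (\<exists>z. {u, z} \<in> edges G \<and> {z, v} \<in> edges G)"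
  proof cases
    case 2
    then show ?thesis using p(1) by (simp add: walk_def)
  next
    case (3 z)
    then have "{p ! i, p ! (i + 1)} \<in> edges G" if "i < 2" for i
      using p(1) that by (simp add: walk_def)
    from this[of 0] this[of 1] show ?thesis using 3 by auto
  qed simp
next
  have V: "x \<in> verts G \<and> y \<in> verts G" if "{x, y} \<in> edges G" for x y
    using assms(1) that by (auto simp: simple_graph_def)
  assume "u = v \<or> {u, v} \<in> edges G \<or> (\<exists>z. {u, z} \<in> edges G \<and> {z, v} \<in> edges G)"
  then consider "u = v" | "{u, v} \<in> edges G" | z where "{u, z} \<in> edges G" "{z, v} \<in> edges G" by blast
  then show "gdist G u v < 3"
  proof cases
    case 1
    then have "walk G u [u] v" using assms by (simp add: walk_def)
    then show ?thesis unfolding gdist_less_iff by (intro exI[of _ "[u]"]) (simp add: numeral_eq_enat)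
  next
    case 2
    then have "walk G u [u, v] v" using V by (auto simp: walk_def)
    then show ?thesis unfolding gdist_less_iff by (intro exI[of _ "[u, v]"]) (simp add: numeral_eq_enat)
  next
    case 3
    then have "walk G u [u, z, v] v" using V by (auto simp: walk_def nth_Cons')
    then show ?thesis unfolding gdist_less_iff by (intro exI[of _ "[u, z, v]"]) (simp add: numeral_eq_enat)
  qed
qed

lemma gdist_1_or_2_iff:
  assumes "simple_graph G" "u \<in> verts G"
  shows "gdist G u v = 1 \<or> gdist G u v = 2 \<longleftrightarrow>
    u \<noteq> v \<and> ({u, v} \<in> edges G \<or> (\<exists>z. {u, z} \<in> edges G \<and> {z, v} \<in> edges G))"
proof -
  have "gdist G u v = 1 \<or> gdist G u v = 2 \<longleftrightarrow> gdist G u v \<noteq> 0 \<and> gdist G u v < 3"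
    by (cases "gdist G u v") (auto simp: zero_enat_def one_enat_def numeral_eq_enat)
  then show ?thesis using gdist_less_3_iff[OF assms] gdist_eq_0_iff[OF assms(2)] by auto
qed

section \<open>Maps that are injective on edges\<close>

text \<open>Such a map may identify vertices, but no two edges, and it collapses no edge. It is what
  remains of an isomorphism while vertices still have to be stuck together.\<close>

definition edge_embedding :: "('a \<Rightarrow> 'b) \<Rightarrow> 'a ugraph \<Rightarrow> bool" where
  "edge_embedding f H \<longleftrightarrow> inj_on ((`) f) (edges H) \<and> (\<forall>e\<in>edges H. card (f ` e) = 2)"

lemma edge_embedding_inj:
  assumes "simple_graph H" "inj_on f (verts H)"
  shows "edge_embedding f H"
  unfolding edge_embedding_def
proof
  have sub: "e \<subseteq> verts H" "card e = 2" if "e \<in> edges H" for e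
    using assms(1) that by (auto simp: simple_graph_def)
  show "inj_on ((`) f) (edges H)"
    using inj_on_image_eq_iff[OF assms(2)] sub by (auto intro!: inj_onI)
  show "\<forall>e\<in>edges H. card (f ` e) = 2"
    using sub assms(2) by (metis card_image inj_on_subset)
qed

text \<open>At distance 1 the edge between the two vertices would collapse; at distance 2 the two edges of a
  path between them would be identified.\<close>

lemma edge_embedding_gdist:
  assumes "simple_graph H" "edge_embedding f H"
    and xy: "x \<in> verts H" "x \<noteq> y" "f x = f y"
  shows "3 \<le> gdist H x y"
proof (rule ccontr)
  have proper: "f a \<noteq> f b" if "{a, b} \<in> edges H" for a b
    using assms(2) that by (auto simp: edge_embedding_def)
  assume "\<not> 3 \<le> gdist H x y"
  then obtain z where z: "{x, z} \<in> edges H" "{z, y} \<in> edges H"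
    using gdist_less_3_iff[OF assms(1) xy(1), of y] proper xy by (auto simp: not_le)
  have "f ` {x, z} = f ` {z, y}" using xy by auto
  then have "{x, z} = {z, y}" using assms(2) z unfolding edge_embedding_def inj_on_def by blast
  then show False using xy(2) by (auto simp: doubleton_eq_iff)
qed

text \<open>The converse of the previous lemma for a single identified pair. For several pairs the distance condition
  would not suffice, since it does not keep apart two edges \<open>ab\<close> and \<open>cd\<close> when \<open>a\<close> is identified
  with \<open>c\<close> and \<open>b\<close> with \<open>d\<close>.\<close>

lemma edge_embedding_identify:
  assumes H: "simple_graph H" and u: "u \<in> verts H" and far: "3 \<le> gdist H u v"
    and f: "\<And>x y. x \<in> verts H \<Longrightarrow> y \<in> verts H \<Longrightarrow> f x = f y \<Longrightarrow> x = y \<or> {x, y} = {u, v}"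
  shows "edge_embedding f H"
proof -
  have uv: "{u, v} \<notin> edges H" and common: "\<And>z. {u, z} \<in> edges H \<Longrightarrow> {z, v} \<notin> edges H"
    using far gdist_less_3_iff[OF H u, of v] by (auto simp: not_le[symmetric])
  have V: "x \<in> verts H \<and> y \<in> verts H" if "{x, y} \<in> edges H" for x y
    using H that by (auto simp: simple_graph_def)
  have same: "x = y" if "f x = f y" "{x, z} \<in> edges H" "{z, y} \<in> edges H" for x y z
    using f[of x y] that V[of x z] V[of z y] common[of z] by (auto simp: doubleton_eq_iff insert_commute)
  have proper: "f x \<noteq> f y" if "{x, y} \<in> edges H" "x \<noteq> y" for x y
    using f[of x y] that V[of x y] uv by auto
  have pair: "{a, b} = {c, d}"
    if "f a = f c" "f b = f d" "{a, b} \<in> edges H" "a \<noteq> b" "{c, d} \<in> edges H" for a b c d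
  proof -
    have "a = c \<or> b = d"
    proof (rule ccontr)
      assume ne: "\<not> (a = c \<or> b = d)"
      \<comment> \<open>Both pairs are the pair \<open>uv\<close>, so that \<open>ab\<close> would be the edge \<open>uv\<close>.\<close>
      have "{a, c} = {u, v}" "{b, d} = {u, v}"
        using f[of a c] f[of b d] that ne V[of a b] V[of c d] by auto
      then have "{a, b} = {u, v}" using that(4) by (auto simp: doubleton_eq_iff)
      then show False using that(3) uv by simp
    qed
    moreover have "a = c" if "b = d"
      using same[of a c b] that \<open>f a = f c\<close> \<open>{a, b} \<in> edges H\<close> \<open>{c, d} \<in> edges H\<close>
      by (simp add: insert_commute)
    moreover have "b = d" if "a = c"
      using same[of b d a] that \<open>f b = f d\<close> \<open>{a, b} \<in> edges H\<close> \<open>{c, d} \<in> edges H\<close>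
      by (simp add: insert_commute)
    ultimately show ?thesis by blast
  qed
  have "e = e'" if e: "e \<in> edges H" "e' \<in> edges H" "f ` e = f ` e'" for e e'
  proof -
    obtain a b where ab: "e = {a, b}" "a \<noteq> b" using H e(1) by (rule simple_graph_edgeE)
    obtain c d where cd: "e' = {c, d}" "c \<noteq> d" using H e(2) by (rule simple_graph_edgeE)
    have "f a = f c \<and> f b = f d \<or> f a = f d \<and> f b = f c"
      using e(3) ab cd by (simp add: doubleton_eq_iff)
    then show ?thesis using pair[of a c b d] pair[of a d b c] ab cd e by (auto simp: insert_commute)
  qed
  moreover have "card (f ` e) = 2" if eH: "e \<in> edges H" for e
  proof -
    obtain a b where ab: "e = {a, b}" "a \<noteq> b" using H eH by (rule simple_graph_edgeE)
    then show ?thesis using proper[of a b] eH by simp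
  qed
  ultimately show ?thesis by (simp add: edge_embedding_def inj_on_def)
qed

lemma edge_embedding_triangle:
  assumes "edge_embedding f H" "T \<in> triangles H"
  shows "inj_on f T"
proof (rule inj_onI, rule ccontr)
  fix x y assume "x \<in> T" "y \<in> T" "f x = f y" "x \<noteq> y"
  then have "{x, y} \<in> edges H" "card (f ` {x, y}) = 1"
    using triangle_edge[OF assms(2)] by auto
  then show False using assms(1) by (auto simp: edge_embedding_def)
qed

lemma edge_embedding_image_triangle:
  assumes "edge_embedding f H" "T \<in> triangles H"
    and "f ` verts H \<subseteq> verts G" "(`) f ` edges H \<subseteq> edges G"
  shows "f ` T \<in> triangles G"
proof -
  have "{f x, f y} \<in> edges G" if "x \<in> T" "y \<in> T" "f x \<noteq> f y" for x y
  proof -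
    have "{x, y} \<in> edges H" using triangle_edge[OF assms(2)] that by auto
    then have "f ` {x, y} \<in> edges G" using assms(4) by blast
    then show ?thesis by simp
  qed
  moreover have "card (f ` T) = 3"
    using card_image[OF edge_embedding_triangle[OF assms(1,2)]] triangles_card[OF assms(2)] by simp
  moreover have "f ` T \<subseteq> verts G"
    using assms(3) triangles_card[OF assms(2)] by blast
  ultimately show ?thesis by (auto simp: triangles_def)
qed

text \<open>A common edge of the two images has a preimage in each triangle, and by injectivity on edges the two
  preimages agree.\<close>

lemma edge_embedding_common_edge:
  assumes emb: "edge_embedding f H" and S: "S \<in> triangles H" and T: "T \<in> triangles H"
  shows "2 \<le> card (f ` S \<inter> f ` T) \<longleftrightarrow> 2 \<le> card (S \<inter> T)"
proof
  have fin: "finite S" "finite T" using S T triangles_card by blast+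
  assume "2 \<le> card (f ` S \<inter> f ` T)"
  then obtain p q where pq: "p \<noteq> q" "{p, q} \<subseteq> f ` S" "{p, q} \<subseteq> f ` T"
    using fin by (auto simp: two_le_card_iff)
  then have im: "p \<in> f ` S" "q \<in> f ` S" "p \<in> f ` T" "q \<in> f ` T" by simp_all
  obtain a b where "a \<in> S" "b \<in> S" "f a = p" "f b = q" using im(1,2) by (elim imageE) simp
  moreover obtain c d where "c \<in> T" "d \<in> T" "f c = p" "f d = q" using im(3,4) by (elim imageE) simp
  ultimately have ab: "a \<in> S" "b \<in> S" "c \<in> T" "d \<in> T" "f a = p" "f b = q" "f c = p" "f d = q"
    by simp_all
  have "{a, b} \<in> edges H" "{c, d} \<in> edges H"
    using triangle_edge S T ab pq(1) by metis+
  moreover have "f ` {a, b} = f ` {c, d}" using ab by simp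
  ultimately have "{a, b} = {c, d}" using emb unfolding edge_embedding_def inj_on_def by blast
  then have "{a, b} \<subseteq> S \<inter> T" "a \<noteq> b" using ab pq(1) by (auto simp: doubleton_eq_iff)
  then show "2 \<le> card (S \<inter> T)" using fin by (intro two_le_cardI[of _ a b]) auto
next
  have fin: "finite S" "finite T" using S T triangles_card by blast+
  assume "2 \<le> card (S \<inter> T)"
  then obtain a b where ab: "a \<noteq> b" "{a, b} \<subseteq> S" "{a, b} \<subseteq> T" using fin by (auto simp: two_le_card_iff)
  then have "f a \<noteq> f b" using edge_embedding_triangle[OF emb S] by (auto dest: inj_onD)
  then show "2 \<le> card (f ` S \<inter> f ` T)" using ab fin by (intro two_le_cardI[of _ "f a" "f b"]) auto
qed

lemma edge_embedding_triangle_inj: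
  assumes "edge_embedding f H" "S \<in> triangles H" "T \<in> triangles H" "f ` S = f ` T"
  shows "S = T"
proof -
  have c3: "card S = 3" "card T = 3" using assms(2,3) triangles_card by blast+
  have "S \<subseteq> T"
  proof
    fix a assume a: "a \<in> S"
    have "\<not> S \<subseteq> {a}" using c3 card_mono[of "{a}" S] by auto
    then obtain b where b: "b \<in> S" "a \<noteq> b" by blast
    have "f a \<in> f ` T" "f b \<in> f ` T" using a b(1) by (simp_all flip: assms(4))
    then obtain c d where cd: "c \<in> T" "d \<in> T" "f c = f a" "f d = f b" by (elim imageE) simp
    have "f a \<noteq> f b" using edge_embedding_triangle[OF assms(1,2)] a b by (auto dest: inj_onD)
    then have "c \<noteq> d" using cd by auto
    then have "{a, b} \<in> edges H" "{c, d} \<in> edges H"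
      using triangle_edge assms(2,3) a b cd by metis+
    moreover have "f ` {a, b} = f ` {c, d}" using cd by simp
    ultimately have "{a, b} = {c, d}" using assms(1) unfolding edge_embedding_def inj_on_def by blast
    then show "a \<in> T" using cd(1,2) by (auto simp: doubleton_eq_iff)
  qed
  then show ?thesis using c3 card_3_sets_eq by blast
qed

lemma edge_embedding_tri_cycle:
  assumes "edge_embedding f H" "set c \<subseteq> triangles H" "tri_cycle c"
  shows "tri_cycle (map ((`) f) c)"
proof -
  have c3: "card (f ` T) = 3" if "T \<in> set c" for T
  proof -
    have T: "T \<in> triangles H" using assms(2) that by blast
    then show ?thesis
      using card_image[OF edge_embedding_triangle[OF assms(1) T]] triangles_card[OF T] by simp
  qed
  have "inj_on ((`) f) (set c)"
    using edge_embedding_triangle_inj[OF assms(1)] assms(2) by (auto intro!: inj_onI)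
  then have "distinct (map ((`) f) c)" using assms(3) by (simp add: distinct_map tri_cycle_def)
  moreover have "2 \<le> card (f ` (c ! i) \<inter> f ` (c ! j)) \<longleftrightarrow> 2 \<le> card (c ! i \<inter> c ! j)"
    if "i < length c" "j < length c" for i j
    using edge_embedding_common_edge[OF assms(1)] assms(2) that by (auto dest: nth_mem)
  ultimately show ?thesis using assms(3) c3 by (simp add: tri_cycle_def)
qed

text \<open>The copy need not be an induced subgraph: the triangle graph of a subgraph is always induced in the
  triangle graph of the whole graph.\<close>

lemma contains_copy_not_chordal:
  assumes "simple_graph G" "simple_graph H" "contains_copy G H"
    and "set c \<subseteq> triangles H" "tri_cycle c" "4 \<le> length c"
  shows "\<not> chordal (triangle_graph G)"
proof -
  obtain g where g: "inj_on g (verts H)" "g ` verts H \<subseteq> verts G" "(`) g ` edges H \<subseteq> edges G"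
    using assms(3) by (rule contains_copyE)
  note emb = edge_embedding_inj[OF assms(2) g(1)]
  have "tri_cycle (map ((`) g) c)" using emb assms(4,5) by (rule edge_embedding_tri_cycle)
  moreover have "set (map ((`) g) c) \<subseteq> triangles G"
    using edge_embedding_image_triangle[OF emb _ g(2,3)] assms(4) by auto
  ultimately show ?thesis
    using induced_cycle_triangle_graph_iff[OF assms(1)] assms(6) unfolding chordal_def
    by (metis length_map)
qed

section \<open>Vertex sticking\<close>

text \<open>Vertex sticking is the quotient that identifies \<open>u\<close> and \<open>v\<close>, with \<open>w\<close> as the name of the new vertex. In
  this form the facts about edge embeddings apply to it.\<close>

lemma vertex_sticking_image:
  assumes H: "simple_graph H" and uv: "u \<in> verts H" "v \<in> verts H" "3 \<le> gdist H u v"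
    and w: "w \<notin> verts H"
  defines "q \<equiv> \<lambda>y. if y = u \<or> y = v then w else y"
  shows "(insert w (verts H - {u, v}),
              {e \<in> edges H. u \<notin> e \<and> v \<notin> e} \<union>
              {{w, y} | y. y \<in> neighborhood H u \<union> neighborhood H v}) = (q ` verts H, (`) q ` edges H)"
    and "edge_embedding q H"
proof -
  show emb: "edge_embedding q H"
    using H uv(1,3) by (rule edge_embedding_identify) (use w in \<open>auto simp: q_def split: if_splits\<close>)
  have V: "x \<in> verts H \<and> y \<in> verts H" if "{x, y} \<in> edges H" for x y
    using H that by (auto simp: simple_graph_def)
  have nuv: "{u, v} \<notin> edges H"
    using uv(3) gdist_less_3_iff[OF H uv(1), of v] by (auto simp: not_le[symmetric])
  have loop: "{x} \<notin> edges H" for x using H by (auto simp: simple_graph_def)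
  have avoid: "q ` e = e" if "u \<notin> e" "v \<notin> e" for e using that by (auto simp: q_def image_iff)
  have at_u: "q ` {u, y} = {w, y}" if "{u, y} \<in> edges H" for y
    using that nuv loop[of u] by (auto simp: q_def)
  have at_v: "q ` {v, y} = {w, y}" if "{v, y} \<in> edges H" for y
    using that nuv loop[of v] by (auto simp: q_def insert_commute)
  have "{e \<in> edges H. u \<notin> e \<and> v \<notin> e} \<union>
      {{w, y} | y. y \<in> neighborhood H u \<union> neighborhood H v} = (`) q ` edges H" (is "?L = ?R")
  proof (intro equalityI subsetI)
    fix e assume "e \<in> ?L"
    then consider "e \<in> edges H" "u \<notin> e" "v \<notin> e" | y where "e = {w, y}" "{u, y} \<in> edges H"
      | y where "e = {w, y}" "{v, y} \<in> edges H" by (auto simp: neighborhood_def)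
    then show "e \<in> ?R"
    proof cases
      case 1 then show ?thesis using avoid[of e] by (auto simp: image_iff)
    next
      case (2 y) then show ?thesis by (simp only: at_u[symmetric] imageI)
    next
      case (3 y) then show ?thesis by (simp only: at_v[symmetric] imageI)
    qed
  next
    fix e assume "e \<in> ?R"
    then obtain d where d: "d \<in> edges H" "e = q ` d" by blast
    obtain a b where ab: "d = {a, b}" using H d(1) by (rule simple_graph_edgeE)
    consider "u \<notin> d" "v \<notin> d" | y where "d = {u, y}" | y where "d = {v, y}"
      using ab by (auto simp: insert_commute)
    then show "e \<in> ?L"
    proof cases
      case 1 then show ?thesis using d avoid[of d] by simp
    next
      case (2 y) then show ?thesis using d at_u[of y] V[of u y] by (auto simp: neighborhood_def)
    next
      case (3 y) then show ?thesis using d at_v[of y] V[of v y] by (auto simp: neighborhood_def)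
    qed
  qed
  moreover have "insert w (verts H - {u, v}) = q ` verts H" using uv by (auto simp: q_def image_iff)
  ultimately show "(insert w (verts H - {u, v}),
              {e \<in> edges H. u \<notin> e \<and> v \<notin> e} \<union>
              {{w, y} | y. y \<in> neighborhood H u \<union> neighborhood H v}) = (q ` verts H, (`) q ` edges H)"
    by simp
qed

lemma edge_embedding_simple_image:
  assumes "simple_graph H" "edge_embedding f H"
  shows "simple_graph (f ` verts H, (`) f ` edges H)"
  using assms by (auto simp: simple_graph_def edge_embedding_def)

lemma simple_graph_complete_graph: "finite A \<Longrightarrow> simple_graph (complete_graph A)"
  by (auto simp: simple_graph_def complete_graph_def)

lemma simple_graph_delete_edges: "simple_graph G \<Longrightarrow> simple_graph (delete_edges G F)"
  by (auto simp: simple_graph_def delete_edges_def)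

lemma simple_graph_cycle_graph: "3 \<le> n \<Longrightarrow> simple_graph (cycle_graph n)"
  by (auto simp: simple_graph_def cycle_graph_def card_insert_if mod_Suc)

lemma simple_graph_square: "simple_graph G \<Longrightarrow> simple_graph (graph_square G)"
  by (auto simp: simple_graph_def graph_square_def card_2_iff gdist_eq_0_iff zero_enat_def[symmetric])
     (metis gdist_eq_0_iff zero_neq_one zero_neq_numeral)+

lemma simple_graph_K6_minus: "simple_graph K6_minus_K3" "simple_graph K6_minus_P4"
  by (auto simp: K6_minus_K3_def K6_minus_P4_def
      intro!: simple_graph_delete_edges simple_graph_complete_graph)

lemma specified_cycle_tri_cycle:
  "simple_graph H \<Longrightarrow> specified_cycle H c \<Longrightarrow> set c \<subseteq> triangles H \<and> tri_cycle c"
  by (simp add: specified_cycle_def induced_cycle_triangle_graph_iff)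

lemma specified_cycleI:
  "simple_graph H \<Longrightarrow> set c \<subseteq> triangles H \<Longrightarrow> tri_cycle c \<Longrightarrow> 4 \<le> length c \<Longrightarrow> specified_cycle H c"
  by (simp add: specified_cycle_def induced_cycle_triangle_graph_iff)

text \<open>For splitting, the cycle condition is part of the definition of the operation; for sticking, it
  follows because the quotient map is an edge embedding.\<close>

lemma weakly_generated_invariant:
  "weakly_generated H c \<Longrightarrow> simple_graph H \<and> set c \<subseteq> triangles H \<and> tri_cycle c \<and> 5 \<le> length c"
proof (induction rule: weakly_generated.induct)
  case (cycle_square m c)
  then have "simple_graph (graph_square (cycle_graph m))"
    by (intro simple_graph_square simple_graph_cycle_graph) simp
  from induced_cycle_triangle_graph_iff[OF this] show ?case
    using cycle_square \<open>simple_graph (graph_square (cycle_graph m))\<close> by simp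
next
  case (K6_minus_K3 c)
  then show ?case using induced_cycle_triangle_graph_iff[OF simple_graph_K6_minus(1)] by (simp add: simple_graph_K6_minus)
next
  case (K6_minus_P4 c)
  then show ?case using induced_cycle_triangle_graph_iff[OF simple_graph_K6_minus(2)] by (simp add: simple_graph_K6_minus)
next
  case (splitting H c H' c')
  then obtain u v x w ts us where
    uv: "private_edge H c {u, v}" and w: "w \<notin> verts H" and
    H': "H' = (insert w (verts H), (edges H - {{u, v}}) \<union> {{u, w}, {w, v}, {w, x}})" and
    c: "c = ts @ [{u, v, x}] @ us" "c' = ts @ [{u, w, x}, {w, v, x}] @ us" and
    spec: "specified_cycle H' c'"
    unfolding weak_edge_splitting_def by blast
  have "{u, v, x} \<in> triangles H" using splitting c by auto
  then have "{u, v, x} \<subseteq> verts H" by (simp add: triangles_def)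
  then have "simple_graph H'" using splitting w by (auto simp: H' simple_graph_def card_2_iff)
  then show ?case using specified_cycle_tri_cycle[OF _ spec] splitting c by auto
next
  case (sticking H c H' c')
  then obtain u v w where
    uv: "u \<in> verts H" "v \<in> verts H" "3 \<le> gdist H u v" and w: "w \<notin> verts H" and
    H': "H' = (insert w (verts H - {u, v}),
              {e \<in> edges H. u \<notin> e \<and> v \<notin> e} \<union>
              {{w, y} | y. y \<in> neighborhood H u \<union> neighborhood H v})" and
    c': "c' = map (\<lambda>T. (\<lambda>y. if y = u \<or> y = v then w else y) ` T) c"
    unfolding weak_vertex_sticking_def by blast
  let ?q = "\<lambda>y. if y = u \<or> y = v then w else y"
  have simp: "simple_graph H" using sticking by simp
  note stick = vertex_sticking_image[OF simp uv w]
  have H'': "H' = (?q ` verts H, (`) ?q ` edges H)" unfolding H' by (rule stick(1))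
  have "simple_graph H'" unfolding H'' using simp stick(2) by (rule edge_embedding_simple_image)
  moreover have "tri_cycle c'" unfolding c' using stick(2) sticking
    by (intro edge_embedding_tri_cycle) auto
  moreover have "set c' \<subseteq> triangles H'"
    using edge_embedding_image_triangle[OF stick(2), of _ H'] sticking by (auto simp: c' H'')
  ultimately show ?case using sticking c' by simp
qed

text \<open>As long as the map identifies two vertices, they are far enough apart to be stuck together, and the map
  factors through the result as an edge embedding. The number of vertices decreases, so that the process
  ends with an injective map, that is, with a copy.\<close>

lemma weakly_generated_copy_from_edge_embedding:
  assumes "weakly_generated H c" "edge_embedding f H"
    and "f ` verts H \<subseteq> verts G" "(`) f ` edges H \<subseteq> edges G"
  shows "\<exists>H' c'. weakly_generated H' c' \<and> contains_copy G H'"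
  using assms
proof (induction "card (verts H)" arbitrary: H c f rule: less_induct)
  case less
  note inv = weakly_generated_invariant[OF less.prems(1)]
  then have simp: "simple_graph H" and fin: "finite (verts H)" by (auto simp: simple_graph_def)
  show ?case
  proof (cases "inj_on f (verts H)")
    case True
    then show ?thesis using contains_copyI[OF simp] less.prems by blast
  next
    case False
    then obtain u v where uv: "u \<in> verts H" "v \<in> verts H" "u \<noteq> v" "f u = f v"
      by (auto simp: inj_on_def)
    have far: "3 \<le> gdist H u v"
      using edge_embedding_gdist[OF simp less.prems(2)] uv by blast
    obtain w where w: "w \<notin> verts H" using fin infinite_UNIV_nat ex_new_if_finite by blast
    let ?q = "\<lambda>y. if y = u \<or> y = v then w else y"
    \<comment> \<open>The new vertex takes over the common image of \<open>u\<close> and \<open>v\<close>, so that \<open>f\<close> factors as \<open>?f' \<circ> ?q\<close>.\<close>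
    let ?H' = "(?q ` verts H, (`) ?q ` edges H)" and ?f' = "f(w := f u)"
    have spec: "specified_cycle H c" using specified_cycleI[OF simp] inv by simp
    have "weak_vertex_sticking H c ?H' (map (\<lambda>T. ?q ` T) c)"
      unfolding weak_vertex_sticking_def
      by (rule conjI[OF spec], rule exI[of _ u], rule exI[of _ v], rule exI[of _ w])
        (intro conjI uv far w refl vertex_sticking_image(1)[OF simp uv(1,2) far w, symmetric])
    then have gen: "weakly_generated ?H' (map (\<lambda>T. ?q ` T) c)"
      using less.prems(1) by (rule weakly_generated.sticking[rotated])
    have comp: "?f' (?q y) = f y" if "y \<in> verts H" for y using that w uv by auto
    have sub: "e \<subseteq> verts H" if "e \<in> edges H" for e
      using simp that by (auto simp: simple_graph_def)
    have compE: "?f' ` ?q ` e = f ` e" if "e \<in> edges H" for e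
      unfolding image_image by (rule image_cong) (use comp sub[OF that] in blast)+
    have "edge_embedding ?f' ?H'"
    proof -
      have "inj_on ((`) ?f') ((`) ?q ` edges H)"
      proof (rule inj_onI)
        fix a b assume ab: "a \<in> (`) ?q ` edges H" "b \<in> (`) ?q ` edges H" "?f' ` a = ?f' ` b"
        obtain d where d: "a = ?q ` d" "d \<in> edges H" using ab(1) by (rule imageE)
        obtain e where e: "b = ?q ` e" "e \<in> edges H" using ab(2) by (rule imageE)
        have "f ` d = f ` e" using ab(3) compE[OF d(2)] compE[OF e(2)] by (simp only: d e)
        have "inj_on ((`) f) (edges H)" using less.prems(2) by (simp add: edge_embedding_def)
        from inj_onD[OF this \<open>f ` d = f ` e\<close> d(2) e(2)] show "a = b" using d(1) e(1) by simp
      qed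
      moreover have "card (?f' ` e) = 2" if "e \<in> (`) ?q ` edges H" for e
        using that less.prems(2) compE by (auto simp: edge_embedding_def)
      ultimately show ?thesis by (simp add: edge_embedding_def)
    qed
    moreover have "?f' ` ?q ` verts H = f ` verts H"
      unfolding image_image by (rule image_cong) (use comp in blast)+
    then have "?f' ` verts ?H' \<subseteq> verts G" using less.prems(3) by (simp only: fst_conv)
    moreover have "(`) ?f' ` (`) ?q ` edges H = (`) f ` edges H"
      unfolding image_image[of "(`) ?f'"] by (rule image_cong) (use compE in blast)+
    then have "(`) ?f' ` edges ?H' \<subseteq> edges G" using less.prems(4) by (simp only: snd_conv)
    moreover have "card (verts ?H') < card (verts H)"
    proof -
      have "\<not> inj_on ?q (verts H)" using uv by (auto simp: inj_on_def)
      then have "card (?q ` verts H) \<noteq> card (verts H)" using eq_card_imp_inj_on[OF fin] by blast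
      with card_image_le[OF fin, of ?q] have "card (?q ` verts H) < card (verts H)"
        by (rule le_neq_implies_less)
      then show ?thesis by (simp only: fst_conv)
    qed
    ultimately show ?thesis using less.hyps[OF _ gen] by blast
  qed
qed

section \<open>Strips of triangles and edge splitting\<close>

text \<open>A triangle \<open>(x, u, v)\<close> of a strip, with its apex \<open>x\<close>: it is entered through the edge \<open>xu\<close> and left through
  the edge \<open>xv\<close>. The third edge \<open>uv\<close> is the private one.\<close>

type_synonym 'a corner = "'a \<times> 'a \<times> 'a"

fun tri :: "'a corner \<Rightarrow> 'a set" where "tri (x, u, v) = {x, u, v}"
fun entry :: "'a corner \<Rightarrow> 'a set" where "entry (x, u, v) = {x, u}"
fun leave :: "'a corner \<Rightarrow> 'a set" where "leave (x, u, v) = {x, v}"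
fun sides :: "'a corner \<Rightarrow> 'a set set" where "sides (x, u, v) = {{x, u}, {x, v}, {u, v}}"
fun relabel :: "('a \<Rightarrow> 'b) \<Rightarrow> 'a corner \<Rightarrow> 'b corner" where
  "relabel f (x, u, v) = (f x, f u, f v)"

definition closed_strip :: "'a corner list \<Rightarrow> bool" where
  "closed_strip D \<longleftrightarrow> D \<noteq> [] \<and> successively (\<lambda>d d'. leave d = entry d') (D @ [hd D])"

text \<open>The graph consists of the triangles of the strip only. This determines the graph from the strip, and makes
  every condition on the graph a condition on the strip.\<close>

definition realises :: "nat ugraph \<Rightarrow> nat corner list \<Rightarrow> bool" where
  "realises H D \<longleftrightarrow> weakly_generated H (map tri D) \<and> closed_strip D \<and>
     verts H = \<Union> (tri ` set D) \<and> edges H = \<Union> (sides ` set D)"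

text \<open>The strip \<open>D\<close> is the image of a strip that belongs to a weakly generated graph. The relabelling may
  identify vertices, so that vertices of \<open>D\<close> may coincide accidentally. The strip \<open>D\<close> is a list of labels
  without a graph, because shortening its runs uses triangles that the original graph does not have.\<close>

definition liftable :: "'a corner list \<Rightarrow> bool" where
  "liftable D \<longleftrightarrow> (\<exists>H D' f. realises H D' \<and> D = map (relabel f) D')"

lemma relabel_cong: "(\<And>y. y \<in> tri d \<Longrightarrow> f y = g y) \<Longrightarrow> relabel f d = relabel g d"
  by (cases d) auto

lemma tri_relabel: "tri (relabel f d) = f ` tri d" by (cases d) auto

lemma closed_strip_neighbours:
  assumes "closed_strip (ts @ [d] @ us)" "ts @ us \<noteq> []"
  shows "entry d = leave (last (us @ ts)) \<and> leave d = entry (hd (us @ ts))"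
  using assms by (cases ts rule: rev_cases; cases us)
    (auto simp: closed_strip_def successively_append_iff successively_Cons hd_append last_append)

lemma closed_strip_split:
  assumes "closed_strip (ts @ [(x, u, v)] @ us)"
  shows "closed_strip (ts @ [(x, u, w), (x, w, v)] @ us)"
  using assms by (cases ts; cases us)
    (auto simp: closed_strip_def successively_append_iff successively_Cons hd_append last_append)

lemma entry_subset_tri: "entry d \<subseteq> tri d" and leave_subset_tri: "leave d \<subseteq> tri d"
  by (cases d; auto)+

lemma sides_subset_tri: "e \<in> sides d \<Longrightarrow> e \<subseteq> tri d" by (cases d) auto

lemma tri_in_triangles:
  "tri d \<subseteq> verts G \<Longrightarrow> sides d \<subseteq> edges G \<Longrightarrow> card (tri d) = 3 \<Longrightarrow> tri d \<in> triangles G"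
  by (cases d) (auto simp: triangles_def insert_commute)

lemma strip_set_triangles:
  assumes "verts H = \<Union> (tri ` set D)" "edges H = \<Union> (sides ` set D)" "tri_cycle (map tri D)"
  shows "set (map tri D) \<subseteq> triangles H"
proof
  fix S assume S: "S \<in> set (map tri D)"
  then obtain d where d: "d \<in> set D" "S = tri d" unfolding set_map by (elim imageE)
  have "card S = 3" using assms(3) S unfolding tri_cycle_def by blast
  moreover have "tri d \<subseteq> verts H" "sides d \<subseteq> edges H" unfolding assms(1,2) using d(1) by blast+
  ultimately show "S \<in> triangles H" unfolding d(2) by (intro tri_in_triangles)
qed

text \<open>Weak edge splitting at \<open>uv\<close>. The triangles before and after \<open>uvx\<close> contain \<open>ux\<close> and \<open>vx\<close>, which leaves \<open>uv\<close>
  as the private edge and makes the two halves of \<open>uvx\<close> fit into the cycle in the order of the strip.\<close>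

lemma realises_split:
  assumes r: "realises H (ts @ [(x, u, v)] @ us)" and w: "w \<notin> verts H"
  shows "realises (insert w (verts H), (edges H - {{u, v}}) \<union> {{u, w}, {w, v}, {w, x}})
    (ts @ [(x, u, w), (x, w, v)] @ us)" (is "realises ?H' ?D'")
proof -
  let ?D = "ts @ [(x, u, v)] @ us" and ?T = "{u, v, x}"
  let ?ts = "map tri ts" and ?us = "map tri us"
  have gen: "weakly_generated H (map tri ?D)" and closed: "closed_strip ?D"
    and V: "verts H = \<Union> (tri ` set ?D)" and E: "edges H = \<Union> (sides ` set ?D)"
    using r by (auto simp: realises_def)
  have c: "map tri ?D = ?ts @ [?T] @ ?us" by auto
  have c': "map tri ?D' = ?ts @ [{u, w, x}, {w, v, x}] @ ?us" by auto
  note inv = weakly_generated_invariant[OF gen, unfolded c]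
  then have simp: "simple_graph H" and cyc: "tri_cycle (?ts @ [?T] @ ?us)"
    and len: "5 \<le> length (?ts @ [?T] @ ?us)" and tris: "set (?ts @ [?T] @ ?us) \<subseteq> triangles H" by auto
  have ne: "u \<noteq> v" "u \<noteq> x" "v \<noteq> x"
    using cyc by (auto simp: tri_cycle_def card_insert_if split: if_splits)
  have wT: "w \<notin> S" if "S \<in> set (?ts @ [?T] @ ?us)" for S
    using tris that w triangles_card by blast
  have nonempty: "us @ ts \<noteq> []" using len by auto
  have "last (?us @ ?ts) = tri (last (us @ ts))" "hd (?us @ ?ts) = tri (hd (us @ ts))"
    using last_map[OF nonempty, of tri] hd_map[OF nonempty, of tri] by simp_all
  moreover have "{x, u} = leave (last (us @ ts))" "{x, v} = entry (hd (us @ ts))"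
    using closed_strip_neighbours[OF closed] nonempty by auto
  ultimately have nb: "{u, x} \<subseteq> last (?us @ ?ts)" "{v, x} \<subseteq> hd (?us @ ?ts)"
    using leave_subset_tri[of "last (us @ ts)"] entry_subset_tri[of "hd (us @ ts)"] by auto
  have cyc': "tri_cycle (?ts @ [{u, w, x}, {w, v, x}] @ ?us)"
    using tri_cycle_split[OF cyc _ nb] len wT by auto
  have distinct: "?T \<notin> set (?us @ ?ts)" using cyc by (auto simp: tri_cycle_def)
  have c3: "card S = 3" "finite S" if "S \<in> set (?us @ ?ts)" for S
  proof -
    have "S \<in> triangles H" using tris that by auto
    from triangles_card[OF this] show "card S = 3" "finite S" by simp_all
  qed
  \<comment> \<open>A further triangle on \<open>uv\<close> would be a third neighbour of \<open>uvx\<close>, besides those on \<open>ux\<close> and \<open>vx\<close>.\<close>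
  have only: "S \<notin> set (?us @ ?ts)" if uv: "{u, v} \<subseteq> S" for S
  proof
    assume S: "S \<in> set (?us @ ?ts)"
    let ?A = "last (?us @ ?ts)" and ?B = "hd (?us @ ?ts)"
    have ring: "?A \<in> set (?us @ ?ts)" "?B \<in> set (?us @ ?ts)"
      using nonempty by (intro last_in_set hd_in_set; auto)+
    have noT: "\<not> ?T \<subseteq> Q" if "Q \<in> set (?us @ ?ts)" for Q
    proof
      assume "?T \<subseteq> Q"
      then have "?T = Q" using card_3_sets_eq[of ?T Q] ne c3[OF that] by auto
      then show False using distinct that by blast
    qed
    have "?A \<noteq> ?B" using noT[OF ring(1)] nb by auto
    moreover have "S \<noteq> ?A" using noT[OF ring(1)] nb uv by auto
    moreover have "S \<noteq> ?B" using noT[OF ring(2)] nb uv by auto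
    moreover have neT: "?T \<noteq> Q" if "Q \<in> set (?us @ ?ts)" for Q
      using distinct that by metis
    note neT[OF ring(1)] neT[OF ring(2)] neT[OF S]
    ultimately have dis: "distinct [?T, ?A, ?B, S]" by simp
    have "2 \<le> card (?T \<inter> ?A)" "2 \<le> card (?T \<inter> ?B)" "2 \<le> card (?T \<inter> S)"
      using nb uv ne two_le_cardI[of "?T \<inter> ?A" u x] two_le_cardI[of "?T \<inter> ?B" v x]
        two_le_cardI[of "?T \<inter> S" u v] by simp_all
    moreover have "{?T, ?A, ?B, S} \<subseteq> set (?ts @ [?T] @ ?us)" using ring S by auto
    ultimately show False using tri_cycle_three_neighbours[OF cyc _ dis] by simp
  qed
  have "{u, v} \<notin> sides d" if "d \<in> set (us @ ts)" for d
  proof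
    assume "{u, v} \<in> sides d"
    then have "{u, v} \<subseteq> tri d" using sides_subset_tri by blast
    then show False using only[of "tri d"] that by auto
  qed
  then have rest: "\<Union> (sides ` set (us @ ts)) - {{u, v}} = \<Union> (sides ` set (us @ ts))" by blast
  have "edges H = \<Union> (sides ` set (us @ ts)) \<union> sides (x, u, v)" using E by auto
  then have "edges H - {{u, v}} = (\<Union> (sides ` set (us @ ts)) - {{u, v}}) \<union> {{x, u}, {x, v}}"
    using ne by (auto simp: doubleton_eq_iff)
  then have E': "edges ?H' = \<Union> (sides ` set ?D')"
    unfolding rest by (auto simp: insert_commute)
  have V': "verts ?H' = \<Union> (tri ` set ?D')" using V by auto
  have simp': "simple_graph ?H'"
    using simp w V by (auto simp: simple_graph_def card_2_iff)
  have tris': "set (map tri ?D') \<subseteq> triangles ?H'"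
    using cyc' unfolding c'[symmetric] by (rule strip_set_triangles[OF V' E'])
  have "specified_cycle H (map tri ?D)"
    using inv c by (intro specified_cycleI) auto
  moreover have "specified_cycle ?H' (map tri ?D')"
    using simp' tris' cyc' len unfolding c' by (intro specified_cycleI) auto
  moreover have "private_edge H (map tri ?D) {u, v}"
  proof -
    have "\<exists>!S. S \<in> set (map tri ?D) \<and> {u, v} \<subseteq> S"
    proof (rule ex1I)
      show "?T \<in> set (map tri ?D) \<and> {u, v} \<subseteq> ?T" unfolding c by simp
      show "S = ?T" if "S \<in> set (map tri ?D) \<and> {u, v} \<subseteq> S" for S
        using only[of S] that unfolding c by auto
    qed
    moreover have "{u, v} \<in> edges H" unfolding E by simp
    ultimately show ?thesis unfolding private_edge_def by (rule conjI[rotated])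
  qed
  ultimately have "weak_edge_splitting H (map tri ?D) ?H' (map tri ?D')"
    unfolding weak_edge_splitting_def
    by (intro conjI exI[of _ u] exI[of _ v] exI[of _ x] exI[of _ w] exI[of _ ?ts] exI[of _ ?us]
        w c c' refl)
  then have "weakly_generated ?H' (map tri ?D')" using gen by (rule weakly_generated.splitting[rotated])
  then show ?thesis
    unfolding realises_def using closed_strip_split[OF closed] V' E' by blast
qed

text \<open>The vertex \<open>w\<close> may already occur in the strip. Its preimage is a fresh vertex nevertheless, since only the
  relabelling has to know about the coincidence.\<close>

lemma liftable_split:
  assumes "liftable (ts @ [(x, u, v)] @ us)"
  shows "liftable (ts @ [(x, u, w), (x, w, v)] @ us)"
proof -
  obtain H D' f where r: "realises H D'" and D: "ts @ [(x, u, v)] @ us = map (relabel f) D'"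
    using assms by (auto simp: liftable_def)
  obtain ts' us' x' u' v' where D': "D' = ts' @ [(x', u', v')] @ us'" and
    eq: "ts = map (relabel f) ts'" "us = map (relabel f) us'" "x = f x'" "u = f u'" "v = f v'"
    using D[symmetric] by (auto simp: map_eq_append_conv map_eq_Cons_conv)
  have "weakly_generated H (map tri D')" using r by (simp add: realises_def)
  from weakly_generated_invariant[OF this] obtain w' where w': "w' \<notin> verts H"
    using ex_new_if_finite[OF infinite_UNIV_nat, of "verts H"] by (auto simp: simple_graph_def)
  let ?f = "f(w' := w)"
  have fresh: "w' \<notin> tri d" if "d \<in> set D'" for d
    using w' that r by (auto simp: realises_def)
  then have same: "relabel ?f d = relabel f d" if "d \<in> set D'" for d
    using fresh[OF that] by (intro relabel_cong) auto
  have "ts @ [(x, u, w), (x, w, v)] @ us =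
      map (relabel ?f) (ts' @ [(x', u', w'), (x', w', v')] @ us')"
    using same fresh[of "(x', u', v')"] by (auto simp: D' eq)
  then show ?thesis
    using realises_split[OF r[unfolded D'] w'] unfolding liftable_def by blast
qed

text \<open>Repeating the head at the end suits rotations and case distinctions on lists; indices modulo the length suit
  strips that are given by formulas.\<close>

lemma successively_closed_iff:
  assumes "xs \<noteq> []"
  shows "successively P (xs @ [hd xs]) \<longleftrightarrow>
    (\<forall>i<length xs. P (xs ! i) (xs ! (Suc i mod length xs)))"
proof -
  have "(xs @ [hd xs]) ! Suc i = xs ! (Suc i mod length xs)" if "i < length xs" for i
    using that assms by (cases "Suc i = length xs") (auto simp: nth_append hd_conv_nth)
  then show ?thesis by (auto simp: successively_conv_nth nth_append)
qed

lemma closed_strip_append_swap: "closed_strip (A @ B) \<Longrightarrow> closed_strip (B @ A)"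
  by (cases "A = []"; cases "B = []") (simp_all add: closed_strip_def successively_append_iff)

section \<open>The base graphs as strips\<close>

lemma strip_induced_cycle:
  assumes "simple_graph H" "verts H = \<Union> (tri ` set D)" "edges H = \<Union> (sides ` set D)"
    "tri_cycle (map tri D)"
  shows "induced_cycle (triangle_graph H) (map tri D)"
  using induced_cycle_triangle_graph_iff[OF assms(1)] strip_set_triangles[OF assms(2-4)] assms(4)
  by blast

text \<open>The strip that turns after every triangle: triangle \<open>j\<close> has apex \<open>j\<close> and joins it to both neighbours on the
  cycle. The summand \<open>k\<close> keeps the predecessor of 0 from being truncated to 0.\<close>

definition square_strip :: "nat \<Rightarrow> nat corner list" where
  "square_strip k = map (\<lambda>j. (j, (j + k - 1) mod k, Suc j mod k)) [0..<k]"

lemma edges_cycle_square: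
  assumes "5 \<le> k"
  shows "edges (graph_square (cycle_graph k)) =
    (\<Union>u<k. {{u, Suc u mod k}, {u, Suc (Suc u mod k) mod k}})"
proof -
  define s where "s u = Suc u mod k" for u
  have s: "s u < k" "s u \<noteq> u" "s (s u) \<noteq> u" if "u < k" for u
    using that assms by (auto simp: s_def mod_Suc)
  have s_inj: "u = v" if "s u = s v" "u < k" "v < k" for u v
    using that by (auto simp: s_def intro: Suc_mod_inj)
  have simple: "simple_graph (cycle_graph k)" using assms by (intro simple_graph_cycle_graph) simp
  have V: "verts (cycle_graph k) = {..<k}" by (simp add: cycle_graph_def)
  have E: "{u, v} \<in> edges (cycle_graph k) \<longleftrightarrow> u < k \<and> v = s u \<or> v < k \<and> u = s v" for u v
    by (auto simp: cycle_graph_def s_def doubleton_eq_iff)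
  have adj: "gdist (cycle_graph k) u v = 1 \<or> gdist (cycle_graph k) u v = 2 \<longleftrightarrow>
      v = s u \<or> u = s v \<or> v = s (s u) \<or> u = s (s v)" if "u < k" "v < k" for u v
  proof -
    have "(\<exists>z. (u < k \<and> z = s u \<or> z < k \<and> u = s z) \<and> (z < k \<and> v = s z \<or> v < k \<and> z = s v)) \<longleftrightarrow>
        u = v \<or> v = s (s u) \<or> u = s (s v)"
      (is "(\<exists>z. ?common z) \<longleftrightarrow> ?R")
    proof
      assume "\<exists>z. ?common z"
      then consider z where "z = s u" "v = s z" | z where "z = s u" "z = s v"
        | z where "u = s z" "v = s z" | z where "u = s z" "z = s v" by blast
      then show ?R by cases (use that s_inj in blast)+
    next
      assume ?R
      then show "\<exists>z. ?common z"
      proof (elim disjE)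
        assume "u = v"
        then show ?thesis using that by (intro exI[of _ "s u"]) simp
      next
        assume "v = s (s u)"
        then show ?thesis using that s(1)[of u] by (intro exI[of _ "s u"]) simp
      next
        assume "u = s (s v)"
        then show ?thesis using that s(1)[of v] by (intro exI[of _ "s v"]) simp
      qed
    qed
    then show ?thesis
      using gdist_1_or_2_iff[OF simple, of u v] that s(2,3)[OF that(1)] s(2,3)[OF that(2)]
      unfolding E V by auto
  qed
  have "edges (graph_square (cycle_graph k)) = (\<Union>u<k. {{u, s u}, {u, s (s u)}})"
    unfolding graph_square_def snd_conv V
  proof (intro equalityI subsetI)
    fix e assume "e \<in> {{u, v} |u v. u \<in> {..<k} \<and> v \<in> {..<k} \<and>
        (gdist (cycle_graph k) u v = 1 \<or> gdist (cycle_graph k) u v = 2)}"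
    then obtain u v where uv: "e = {u, v}" "u < k" "v < k"
      "gdist (cycle_graph k) u v = 1 \<or> gdist (cycle_graph k) u v = 2" by auto
    then consider "v = s u" | "u = s v" | "v = s (s u)" | "u = s (s v)" using adj[of u v] by blast
    then show "e \<in> (\<Union>u<k. {{u, s u}, {u, s (s u)}})"
      by cases (use uv insert_commute[of u v "{}"] in \<open>simp; blast\<close>)+
  next
    fix e assume "e \<in> (\<Union>u<k. {{u, s u}, {u, s (s u)}})"
    then obtain u v where uv: "u < k" "e = {u, v}" "v = s u \<or> v = s (s u)" by auto
    moreover from this have "v < k" using s(1) by auto
    ultimately show "e \<in> {{u, v} |u v. u \<in> {..<k} \<and> v \<in> {..<k} \<and>
        (gdist (cycle_graph k) u v = 1 \<or> gdist (cycle_graph k) u v = 2)}"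
      using adj[of u v] by blast
  qed
  then show ?thesis by (simp add: s_def)
qed

text \<open>Triangles \<open>j\<close> and \<open>j + 2\<close> share the vertex \<open>j + 1\<close>. They would share a second one only if going four steps
  around the cycle led back to the start, and this is where \<open>k \<ge> 5\<close> enters.\<close>

lemma realises_square_strip:
  assumes "5 \<le> k"
  shows "realises (graph_square (cycle_graph k)) (square_strip k)"
proof -
  define s where "s u = Suc u mod k" for u
  define p where "p u = (u + k - 1) mod k" for u
  have s_if: "s u = (if Suc u = k then 0 else Suc u)" if "u < k" for u
    using that by (auto simp: s_def)
  have p_if: "p u = (if u = 0 then k - 1 else u - 1)" if "u < k" for u
    using that by (cases u) (auto simp: p_def)
  have s: "s u < k" "p u < k" "s (p u) = u" "p (s u) = u" "s (s (s (s u))) \<noteq> u" "p u \<noteq> u" "s u \<noteq> u"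
    "s u \<noteq> p u" "s (s u) \<noteq> p u" "s (s u) \<noteq> u" if "u < k" for u
    using that assms by (simp_all add: s_if p_if split: if_splits) auto
  let ?D = "square_strip k" and ?H = "graph_square (cycle_graph k)"
  have D: "?D = map (\<lambda>j. (j, p j, s j)) [0..<k]" by (simp add: square_strip_def s_def p_def)
  have nth: "?D ! j = (j, p j, s j)" if "j < k" for j using that by (simp add: D)
  have len: "length ?D = k" "?D \<noteq> []" using assms by (auto simp: D)
  have V: "verts ?H = \<Union> (tri ` set ?D)"
    using s by (auto simp: D graph_square_def cycle_graph_def)
  have E: "edges ?H = \<Union> (sides ` set ?D)"
  proof -
    have "(\<Union>u<k. {{u, s u}, {u, s (s u)}}) = (\<Union>j<k. {{j, p j}, {j, s j}, {p j, s j}})" (is "?L = ?R")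
    proof (intro equalityI UN_least)
      fix u assume u: "u \<in> {..<k}"
      then have "{u, s (s u)} = {p (s u), s (s u)}" "s u < k" using s by simp_all
      then show "{{u, s u}, {u, s (s u)}} \<subseteq> ?R" using u by blast
    next
      fix j assume j: "j \<in> {..<k}"
      then have "{j, p j} = {p j, s (p j)}" "{p j, s j} = {p j, s (s (p j))}" "p j < k"
        using s by (simp_all add: insert_commute)
      then show "{{j, p j}, {j, s j}, {p j, s j}} \<subseteq> ?L" using j by blast
    qed
    then show ?thesis
      unfolding edges_cycle_square[OF assms] s_def[symmetric]
      by (simp add: D lessThan_atLeast0)
  qed
  have closed: "closed_strip ?D"
    unfolding closed_strip_def successively_closed_iff[OF len(2)]
    using len(2) by (auto simp: len nth s s_def[symmetric] insert_commute)
  have cyc: "tri_cycle (map tri ?D)"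
  proof -
    have shared: "2 \<le> card ({i, p i, s i} \<inter> {j, p j, s j}) \<longleftrightarrow> j = s i \<or> i = s j"
      if ij: "i < k" "j < k" "i \<noteq> j" for i j
    proof
      assume "2 \<le> card ({i, p i, s i} \<inter> {j, p j, s j})"
      then obtain a b where ab: "a \<noteq> b" "a \<in> {i, p i, s i} \<inter> {j, p j, s j}"
        "b \<in> {i, p i, s i} \<inter> {j, p j, s j}" by (auto simp: two_le_card_iff)
      show "j = s i \<or> i = s j"
      proof (rule ccontr)
        assume no: "\<not> (j = s i \<or> i = s j)"
        have "p i \<noteq> p j" "s i \<noteq> s j" "p i \<noteq> j" "i \<noteq> p j"
          using s(3,4)[OF ij(1)] s(3,4)[OF ij(2)] ij(3) no by metis+
        then have neq: "i \<noteq> j" "p i \<noteq> p j" "s i \<noteq> s j" "p i \<noteq> j" "i \<noteq> p j" "s i \<noteq> j" "i \<noteq> s j"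
          using ij(3) no by simp_all
        have claim: "a = s i \<and> s i = p j \<or> a = p i \<and> p i = s j"
          if "a \<in> {i, p i, s i}" "a \<in> {j, p j, s j}" for a
          using that by (elim insertE emptyE) (simp_all add: neq neq[symmetric])
        from claim[OF IntD1[OF ab(2)] IntD2[OF ab(2)]] claim[OF IntD1[OF ab(3)] IntD2[OF ab(3)]] ab(1)
        have "s i = p j \<and> p i = s j" by (elim disjE conjE; simp)
        then have "s (s i) = j" "s (s j) = i" using s(3)[OF ij(1)] s(3)[OF ij(2)] by metis+
        then show False using s(5)[OF ij(1)] by simp
      qed
    next
      assume "j = s i \<or> i = s j"
      then have "{i, j} \<subseteq> {i, p i, s i} \<inter> {j, p j, s j}" using s ij by auto
      then show "2 \<le> card ({i, p i, s i} \<inter> {j, p j, s j})"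
        using ij by (intro two_le_cardI[of _ i j]) auto
    qed
    moreover have card3: "card {i, p i, s i} = 3" if "i < k" for i
      using s[OF that] by (simp add: card_insert_if)
    moreover have "i = j" if ij: "{i, p i, s i} = {j, p j, s j}" "i < k" "j < k" for i j
    proof (rule ccontr)
      assume "i \<noteq> j"
      moreover have "2 \<le> card ({i, p i, s i} \<inter> {j, p j, s j})"
        using card3[OF ij(2)] by (simp flip: ij(1))
      ultimately have "j = s i \<or> i = s j" using shared ij by blast
      moreover have "s (s i) \<notin> {i, p i, s i}" if "i < k" for i
        using s[OF that] s(7)[OF s(1)[OF that]] s(9,10)[OF that] by auto
      then have "s (s i) \<notin> {i, p i, s i}" "s (s j) \<notin> {j, p j, s j}" using ij(2,3) by blast+
      ultimately show False using ij(1) by blast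
    qed
    then have "distinct (map tri ?D)" by (auto simp: D distinct_map inj_on_def)
    ultimately show ?thesis using assms s
      by (auto simp: tri_cycle_def len nth s_def[symmetric] D)
  qed
  have "simple_graph ?H" using assms by (intro simple_graph_square simple_graph_cycle_graph) simp
  then have "weakly_generated ?H (map tri ?D)"
    using strip_induced_cycle[OF _ V E cyc] assms len
    by (intro weakly_generated.cycle_square) auto
  then show ?thesis using closed V E by (simp add: realises_def)
qed

lemma liftableI: "realises H D \<Longrightarrow> liftable (map (relabel f) D)"
  unfolding liftable_def by blast

lemma edges_complete_graph: "edges (complete_graph A) = Set.filter (\<lambda>e. card e = 2) (Pow A)"
  by (auto simp: complete_graph_def)

text \<open>Three runs of two triangles, around the mutually adjacent vertices 3, 4 and 5. The vertices 0, 1, 2, which span no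
  edge, are the rim vertices inside the three fans.\<close>

definition K6_minus_K3_strip :: "nat corner list" where
  "K6_minus_K3_strip = [(3,5,0), (3,0,4), (4,3,1), (4,1,5), (5,4,2), (5,2,3)]"

text \<open>Four runs, around 4, 5, 0 and 3, of 2, 2, 1 and 1 triangles. The inner rim vertices are 1 and 2, so that the missing
  edges are those of the path 0, 1, 2, 3.\<close>

definition K6_minus_P4_strip :: "nat corner list" where
  "K6_minus_P4_strip = [(4,3,1), (4,1,5), (5,4,2), (5,2,0), (0,5,3), (3,0,4)]"

lemma lessThan_6: "{..<6::nat} = {0, 1, 2, 3, 4, 5}" and lessThan_3: "{..<3::nat} = {0, 1, 2}"
  by auto

lemma tri_cycle_K6_minus_K3_strip: "tri_cycle (map tri K6_minus_K3_strip)"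
  by code_simp

lemma tri_cycle_K6_minus_P4_strip: "tri_cycle (map tri K6_minus_P4_strip)"
  by code_simp

lemma edges_K6_minus_K3: "edges K6_minus_K3 = \<Union> (sides ` set K6_minus_K3_strip)"
  unfolding K6_minus_K3_def delete_edges_def snd_conv edges_complete_graph lessThan_6 lessThan_3
  by code_simp

lemma edges_path_graph_4: "edges (path_graph 4) = {{0, 1}, {1, 2}, {2, 3}}"
  by (auto simp: path_graph_def)

lemma edges_K6_minus_P4: "edges K6_minus_P4 = \<Union> (sides ` set K6_minus_P4_strip)"
  unfolding K6_minus_P4_def delete_edges_def snd_conv edges_complete_graph lessThan_6 edges_path_graph_4
  by code_simp

lemma realises_K6_minus_K3_strip: "realises K6_minus_K3 K6_minus_K3_strip"
proof -
  let ?D = K6_minus_K3_strip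
  have V: "verts K6_minus_K3 = \<Union> (tri ` set ?D)"
    by (auto simp: K6_minus_K3_def delete_edges_def complete_graph_def K6_minus_K3_strip_def)
  have "weakly_generated K6_minus_K3 (map tri ?D)"
    using strip_induced_cycle[OF simple_graph_K6_minus(1) V edges_K6_minus_K3 tri_cycle_K6_minus_K3_strip]
    by (intro weakly_generated.K6_minus_K3) (auto simp: K6_minus_K3_strip_def)
  moreover have "closed_strip ?D" by (auto simp: closed_strip_def K6_minus_K3_strip_def)
  ultimately show ?thesis using V edges_K6_minus_K3 by (simp add: realises_def)
qed

lemma liftable_K6_minus_K3:
  "liftable [(x, z, r), (x, r, y), (y, x, s), (y, s, z), (z, y, t), (z, t, x)]"
  using liftableI[OF realises_K6_minus_K3_strip, of "\<lambda>n. [r, s, t, x, y, z] ! n"]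
  by (simp add: K6_minus_K3_strip_def)

text \<open>The rotations are needed because splitting keeps the starting point of the cycle, while the
  two consecutive long runs of a strip with four turns can be anywhere.\<close>

lemma realises_K6_minus_P4_strip:
  assumes "A @ B = K6_minus_P4_strip"
  shows "realises K6_minus_P4 (B @ A)"
proof -
  let ?D = K6_minus_P4_strip
  have same: "set (B @ A) = set ?D" unfolding assms[symmetric] by auto
  have len: "length (B @ A) = 6"
    using arg_cong[OF assms, of length] by (simp add: K6_minus_P4_strip_def)
  have V: "verts K6_minus_P4 = \<Union> (tri ` set (B @ A))" unfolding same
    by (auto simp: K6_minus_P4_def delete_edges_def complete_graph_def K6_minus_P4_strip_def)
  have E: "edges K6_minus_P4 = \<Union> (sides ` set (B @ A))" unfolding same by (rule edges_K6_minus_P4)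
  have "tri_cycle (map tri (B @ A))"
    using tri_cycle_K6_minus_P4_strip tri_cycle_append_swap[of "map tri A" "map tri B"]
    by (simp flip: assms)
  then have "weakly_generated K6_minus_P4 (map tri (B @ A))"
    using strip_induced_cycle[OF simple_graph_K6_minus(2) V E] len
    by (intro weakly_generated.K6_minus_P4) auto
  moreover have "closed_strip ?D" by (auto simp: closed_strip_def K6_minus_P4_strip_def)
  then have "closed_strip (B @ A)" using closed_strip_append_swap[of A B] assms by simp
  ultimately show ?thesis using V E by (simp add: realises_def)
qed

lemma liftable_K6_minus_P4:
  assumes "A @ B = [(x, t, r), (x, r, y), (y, x, s), (y, s, z), (z, y, t), (t, z, x)]"
  shows "liftable (B @ A)"
proof -
  let ?f = "\<lambda>n. [z, r, s, t, x, y] ! n"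
  have "A @ B = map (relabel ?f) K6_minus_P4_strip"
    unfolding assms by (simp add: K6_minus_P4_strip_def)
  then obtain A' B' where "K6_minus_P4_strip = A' @ B'" "A = map (relabel ?f) A'" "B = map (relabel ?f) B'"
    unfolding append_eq_map_conv by blast
  then show ?thesis using liftableI[OF realises_K6_minus_P4_strip, of A' B' ?f] by simp
qed

section \<open>Fans and runs\<close>

fun fan :: "'a \<Rightarrow> 'a list \<Rightarrow> 'a corner list" where
  "fan x (p # q # ps) = (x, p, q) # fan x (q # ps)"
| "fan x ps = []"

lemma fan_snoc: "fan x (P @ [m, q]) = fan x (P @ [m]) @ [(x, m, q)]"
  by (induction x P rule: fan.induct) auto

lemma fan_first:
  assumes "2 \<le> length P"
  shows "\<exists>b ps. P = hd P # b # ps \<and> fan x P = (x, hd P, b) # fan x (b # ps)"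
proof -
  obtain p b ps where "P = p # b # ps" using assms by (cases P; cases "tl P") auto
  then show ?thesis by simp
qed

lemma fan_last:
  assumes "2 \<le> length P"
  shows "\<exists>m ps. fan x P = fan x (ps @ [m]) @ [(x, m, last P)]"
proof -
  obtain Q q where Q: "P = Q @ [q]" using assms by (cases P rule: rev_cases) auto
  then obtain ps m where "Q = ps @ [m]" using assms by (cases Q rule: rev_cases) auto
  then show ?thesis using fan_snoc[of x ps m q] by (auto simp: Q)
qed

text \<open>A fan arises from the single triangle on the end points of its rim, by inserting the inner rim vertices
  one after the other.\<close>

lemma liftable_fan:
  assumes "2 \<le> length P" "liftable (ts @ [(x, hd P, last P)] @ us)"
  shows "liftable (ts @ fan x P @ us)"
proof -
  have "liftable (ts @ fan x (p # ps @ [q]) @ us)" if "liftable (ts @ [(x, p, q)] @ us)" for p q ps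
    using that
  proof (induction ps arbitrary: p ts)
    case (Cons r ps)
    have "liftable ((ts @ [(x, p, r)]) @ [(x, r, q)] @ us)"
      using liftable_split[OF Cons.prems, of r] by simp
    from Cons.IH[OF this] show ?case by simp
  qed simp
  moreover obtain p ps q where "P = p # ps @ [q]"
  proof -
    obtain p Q where "P = p # Q" "Q \<noteq> []" using assms(1) by (cases P; cases "tl P") auto
    then show ?thesis using that[of p "butlast Q" "last Q"] by simp
  qed
  ultimately show ?thesis using assms(2) by simp
qed

text \<open>The variant that stops at a fan of two triangles, for the runs that cannot be shortened further.\<close>

lemma liftable_fan_inner:
  assumes "3 \<le> length P"
    and "liftable (ts @ [(x, hd P, hd (tl P)), (x, hd (tl P), last P)] @ us)"
  shows "liftable (ts @ fan x P @ us)"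
proof -
  obtain p r ps where P: "P = p # r # ps" "ps \<noteq> []"
    using assms(1) by (cases P; cases "tl P"; cases "tl (tl P)") auto
  have "liftable ((ts @ [(x, p, r)]) @ fan x (r # ps) @ us)"
    using assms(2) P by (intro liftable_fan) (auto simp: Suc_le_eq)
  then show ?thesis by (simp add: P)
qed

text \<open>An apex together with the rim of the fan around it.\<close>

type_synonym 'a run = "'a \<times> 'a list"

definition strip_of_runs :: "'a run list \<Rightarrow> 'a corner list" where
  "strip_of_runs Rs = concat (map (\<lambda>(x, P). fan x P) Rs)"

text \<open>At a turn, the last rim vertex becomes the apex, and the old apex becomes the first rim vertex.\<close>

definition turn :: "'a run \<Rightarrow> 'a run \<Rightarrow> bool" where
  "turn r r' \<longleftrightarrow> last (snd r) = fst r' \<and> hd (snd r') = fst r"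

lemma liftable_runs:
  assumes "\<forall>(x, P)\<in>set Rs. 2 \<le> length P"
    and "liftable (ts @ map (\<lambda>(x, P). (x, hd P, last P)) Rs @ us)"
  shows "liftable (ts @ strip_of_runs Rs @ us)"
  using assms
proof (induction Rs arbitrary: ts)
  case (Cons r Rs)
  obtain x P where r: "r = (x, P)" by (cases r)
  have "liftable ((ts @ [(x, hd P, last P)]) @ strip_of_runs Rs @ us)"
    using Cons.prems by (intro Cons.IH) (auto simp: r)
  then have "liftable (ts @ fan x P @ strip_of_runs Rs @ us)"
    using Cons.prems(1) by (intro liftable_fan) (auto simp: r)
  then show ?case by (simp add: strip_of_runs_def r)
qed (simp add: strip_of_runs_def)

text \<open>The common edge \<open>{x, v} = {x', u'}\<close> of two consecutive triangles leaves two possibilities: the next triangle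
  continues the fan, or it starts a new run with a turn. The statement about the ends is needed to close the
  sequence of runs cyclically.\<close>

lemma runs_exist:
  assumes "D \<noteq> []" "successively (\<lambda>d d'. leave d = entry d') D"
  shows "\<exists>Rs. Rs \<noteq> [] \<and> D = strip_of_runs Rs \<and> successively turn Rs \<and>
    (\<forall>(x, P)\<in>set Rs. 2 \<le> length P) \<and>
    fst (hd Rs) = fst (hd D) \<and> hd (snd (hd Rs)) = fst (snd (hd D)) \<and>
    fst (last Rs) = fst (last D) \<and> last (snd (last Rs)) = snd (snd (last D))"
  using assms
proof (induction D rule: list_nonempty_induct)
  case (single d)
  obtain x u v where "d = (x, u, v)" by (cases d)
  then show ?case by (intro exI[of _ "[(x, [u, v])]"]) (simp add: strip_of_runs_def)
next
  case (cons d D)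
  obtain x u v where d: "d = (x, u, v)" by (cases d)
  obtain Rs where Rs: "Rs \<noteq> []" "D = strip_of_runs Rs" "successively turn Rs"
    "\<forall>(x, P)\<in>set Rs. 2 \<le> length P"
    "fst (hd Rs) = fst (hd D)" "hd (snd (hd Rs)) = fst (snd (hd D))"
    "fst (last Rs) = fst (last D)" "last (snd (last Rs)) = snd (snd (last D))"
    using cons by (auto simp: successively_Cons)
  obtain y P R where R: "Rs = (y, P) # R" using Rs(1) by (cases Rs) auto
  obtain b ps where P: "P = hd P # b # ps" "fan x P = (x, hd P, b) # fan x (b # ps)"
    using Rs(4) R fan_first by (metis case_prodD list.set_intros(1))
  have "leave d = entry (hd D)" using cons by (auto simp: successively_Cons)
  moreover have "entry (hd D) = {y, hd P}" using Rs(5,6) R by (cases "hd D") auto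
  ultimately have "x = y \<and> v = hd P \<or> v = y \<and> x = hd P" by (auto simp: d doubleton_eq_iff)
  then show ?case
  proof
    assume stay: "x = y \<and> v = hd P"
    let ?Rs = "(x, u # P) # R"
    have "fan x (u # P) = (x, u, v) # fan x P" using P(1) stay by (metis fan.simps(1))
    then have "d # D = strip_of_runs ?Rs" using stay by (simp add: Rs(2) R strip_of_runs_def d)
    moreover have "successively turn ?Rs" "\<forall>(x, P)\<in>set ?Rs. 2 \<le> length P"
      using Rs(3,4) stay P(1) by (auto simp: R successively_Cons turn_def)
    moreover have "fst (last ?Rs) = fst (last (d # D))"
      "last (snd (last ?Rs)) = snd (snd (last (d # D)))"
      using Rs(7,8) cons(1) P(1) stay by (cases "R = []"; force simp: R)+
    moreover have "?Rs \<noteq> []" "fst (hd ?Rs) = fst (hd (d # D))"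
      "hd (snd (hd ?Rs)) = fst (snd (hd (d # D)))" by (simp_all add: d)
    ultimately show ?thesis by blast
  next
    assume turn: "v = y \<and> x = hd P"
    show ?thesis using Rs turn cons(1)
      by (intro exI[of _ "(x, [u, v]) # Rs"]) (auto simp: strip_of_runs_def d R turn_def successively_Cons)
  qed
qed

section \<open>The number of turns\<close>

text \<open>If the middle run were a single triangle, this would be the triangle of the three apexes. Its edge \<open>xz\<close> is
  also the edge where the third run turns into the first, so that it would lie in three triangles.\<close>

lemma three_runs_inner:
  assumes cyc: "tri_cycle (map tri (fan x P @ fan y Q @ fan z R))" "4 \<le> length (fan x P @ fan y Q @ fan z R)"
    and len: "2 \<le> length P" "2 \<le> length Q" "2 \<le> length R"
    and turns: "turn (x, P) (y, Q)" "turn (y, Q) (z, R)" "turn (z, R) (x, P)"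
  shows "3 \<le> length Q"
proof (rule ccontr)
  assume "\<not> 3 \<le> length Q"
  then have "length Q = 2" using len by simp
  then have Q: "Q = [x, z]" using turns by (auto simp: turn_def length_Suc_conv numeral_2_eq_2)
  obtain b ps where P: "fan x P = (x, z, b) # fan x (b # ps)"
    using fan_first[OF len(1), where x = x] turns(3) by (auto simp: turn_def)
  obtain m rs where R: "fan z R = fan z (rs @ [m]) @ [(z, m, x)]"
    using fan_last[OF len(3), where x = z] turns(3) by (auto simp: turn_def)
  note D = cyc[unfolded Q P R]
  have "card {y, x, z} = 3" using D(1) by (simp add: tri_cycle_def)
  then have "x \<noteq> z" by (auto simp: card_insert_if split: if_splits)
  moreover have "distinct [{x, z, b}, {y, x, z}, {z, m, x}]" using D(1) by (auto simp: tri_cycle_def)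
  ultimately show False
    using tri_cycle_common_edge[of _ "{x, z, b}" "{y, x, z}" "{z, m, x}" x z, OF D(1)] D(2) by auto
qed

text \<open>If two opposite runs were single triangles, both would contain the apexes \<open>t\<close> and \<open>y\<close> of the
  other two runs. Then the first one would have three neighbours.\<close>

lemma four_runs_inner:
  assumes cyc: "tri_cycle (map tri (fan x P @ fan y Q @ fan z R @ fan t S))"
    and len: "2 \<le> length P" "2 \<le> length Q" "2 \<le> length R" "2 \<le> length S"
    and turns: "turn (x, P) (y, Q)" "turn (y, Q) (z, R)" "turn (z, R) (t, S)" "turn (t, S) (x, P)"
  shows "3 \<le> length P \<or> 3 \<le> length R"
proof (rule ccontr)
  assume "\<not> (3 \<le> length P \<or> 3 \<le> length R)"
  then have "length P = 2" "length R = 2" using len by simp_all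
  then have PR: "P = [t, y]" "R = [y, t]"
    using turns by (auto simp: turn_def length_Suc_conv numeral_2_eq_2)
  obtain b ps where Q: "fan y Q = (y, x, b) # fan y (b # ps)"
    using fan_first[OF len(2), where x = y] turns(1) by (auto simp: turn_def)
  obtain m rs where S: "fan t S = fan t (rs @ [m]) @ [(t, m, x)]"
    using fan_last[OF len(4), where x = t] turns(4) by (auto simp: turn_def)
  have cyc': "tri_cycle (map tri ([(x, t, y)] @ ((y, x, b) # fan y (b # ps)) @ [(z, y, t)] @
      fan t (rs @ [m]) @ [(t, m, x)]))" using cyc by (simp add: PR Q S)
  note D = this
  have "card {x, t, y} = 3" using D by (simp add: tri_cycle_def)
  then have ne: "x \<noteq> t" "x \<noteq> y" "t \<noteq> y" by (auto simp: card_insert_if split: if_splits)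
  have generic: "distinct (a # b # X @ c # Y @ [d]) \<Longrightarrow> distinct [a, c, b, d]"
    for a b c d :: "'a set" and X Y by auto
  have distinct: "distinct [{x, t, y}, {z, y, t}, {y, x, b}, {t, m, x}]"
    by (rule generic[of _ _ "map tri (fan y (b # ps))" _ "map tri (fan t (rs @ [m]))"])
      (use cyc' in \<open>simp only: tri_cycle_def map_append list.map tri.simps append.simps\<close>)
  have cards: "2 \<le> card ({x, t, y} \<inter> {z, y, t})" "2 \<le> card ({x, t, y} \<inter> {y, x, b})"
    "2 \<le> card ({x, t, y} \<inter> {t, m, x})"
    using ne by (intro two_le_cardI[of _ t y] two_le_cardI[of _ x y] two_le_cardI[of _ x t]; auto)+
  have sub: "{{x, t, y}, {z, y, t}, {y, x, b}, {t, m, x}} \<subseteq> set (map tri ([(x, t, y)] @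
      ((y, x, b) # fan y (b # ps)) @ [(z, y, t)] @ fan t (rs @ [m]) @ [(t, m, x)]))"
    by simp
  show False by (rule tri_cycle_three_neighbours[OF cyc' sub distinct cards])
qed

text \<open>The edge between the two apexes would lie in the first and in the last triangle of either run, and at
  least three of these are different.\<close>

lemma two_runs_impossible:
  assumes cyc: "tri_cycle (map tri (fan x P @ fan y Q))" "4 \<le> length (fan x P @ fan y Q)"
    and len: "2 \<le> length P" "2 \<le> length Q"
    and turns: "turn (x, P) (y, Q)" "turn (y, Q) (x, P)"
  shows False
proof -
  obtain b ps where P: "P = y # b # ps" "fan x P = (x, y, b) # fan x (b # ps)"
    using fan_first[OF len(1), where x = x] turns(2) by (auto simp: turn_def)
  obtain c qs where Q: "fan y Q = (y, x, c) # fan y (c # qs)"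
    using fan_first[OF len(2), where x = y] turns(1) by (auto simp: turn_def)
  have "card {x, y, b} = 3" using cyc(1) P(2) by (simp add: tri_cycle_def)
  then have ne: "x \<noteq> y" "y \<noteq> b" by (auto simp: card_insert_if split: if_splits)
  then have "ps \<noteq> []" using turns(1) P(1) by (auto simp: turn_def)
  then have "2 \<le> length (b # ps)" by (cases ps) auto
  then obtain m rs where B: "fan x (b # ps) = fan x (rs @ [m]) @ [(x, m, y)]"
    using fan_last[of "b # ps", where x = x] turns(1) P(1) \<open>ps \<noteq> []\<close> by (auto simp: turn_def)
  note D = cyc[unfolded P(2) B Q]
  have "distinct [{x, y, b}, {x, m, y}, {y, x, c}]" using D(1) by (auto simp: tri_cycle_def)
  then show False
    using tri_cycle_common_edge[of _ "{x, y, b}" "{x, m, y}" "{y, x, c}" x y, OF D(1)] D(2) ne by auto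
qed

text \<open>By symmetry all three runs have an inner rim vertex. With one such vertex kept in each run, the strip is that
  of \<open>K\<^sub>6 - K\<^sub>3\<close>.\<close>

lemma liftable_three_runs:
  assumes cyc: "tri_cycle (map tri (fan x P @ fan y Q @ fan z R))" "4 \<le> length (fan x P @ fan y Q @ fan z R)"
    and len: "2 \<le> length P" "2 \<le> length Q" "2 \<le> length R"
    and turns: "turn (x, P) (y, Q)" "turn (y, Q) (z, R)" "turn (z, R) (x, P)"
  shows "liftable (fan x P @ fan y Q @ fan z R)"
proof -
  have "tri_cycle (map tri (fan y Q @ fan z R @ fan x P))" "tri_cycle (map tri (fan z R @ fan x P @ fan y Q))"
    using tri_cycle_append_swap[of "map tri (fan x P)" "map tri (fan y Q @ fan z R)"]
      tri_cycle_append_swap[of "map tri (fan x P @ fan y Q)" "map tri (fan z R)"] cyc(1) by simp_all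
  then have long: "3 \<le> length P" "3 \<le> length Q" "3 \<le> length R"
    using three_runs_inner[of z R x P y Q] three_runs_inner[OF assms] three_runs_inner[of y Q z R x P]
      cyc(2) len turns by simp_all
  let ?p = "hd (tl P)" and ?q = "hd (tl Q)" and ?r = "hd (tl R)"
  let ?P = "[(x, hd P, ?p), (x, ?p, last P)]" and ?Q = "[(y, hd Q, ?q), (y, ?q, last Q)]"
    and ?R = "[(z, hd R, ?r), (z, ?r, last R)]"
  have "liftable ((?P @ ?Q) @ ?R @ [])"
    using liftable_K6_minus_K3[of x z ?p y ?q ?r] turns by (simp add: turn_def)
  then have "liftable ((?P @ ?Q) @ fan z R @ [])" by (rule liftable_fan_inner[OF long(3)])
  then have "liftable (?P @ ?Q @ fan z R)" by simp
  then have "liftable (?P @ fan y Q @ fan z R)" by (rule liftable_fan_inner[OF long(2)])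
  then have "liftable ([] @ ?P @ (fan y Q @ fan z R))" by simp
  then have "liftable ([] @ fan x P @ (fan y Q @ fan z R))" by (rule liftable_fan_inner[OF long(1)])
  then show ?thesis by simp
qed

text \<open>Of each pair of opposite runs, one has an inner rim vertex, hence two consecutive runs do. With these
  two vertices kept, the strip is a rotation of that of \<open>K\<^sub>6 - P\<^sub>4\<close>.\<close>

lemma liftable_four_runs:
  assumes cyc: "tri_cycle (map tri (fan x P @ fan y Q @ fan z R @ fan t S))"
    and len: "2 \<le> length P" "2 \<le> length Q" "2 \<le> length R" "2 \<le> length S"
    and turns: "turn (x, P) (y, Q)" "turn (y, Q) (z, R)" "turn (z, R) (t, S)" "turn (t, S) (x, P)"
  shows "liftable (fan x P @ fan y Q @ fan z R @ fan t S)"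
proof -
  have "tri_cycle (map tri (fan y Q @ fan z R @ fan t S @ fan x P))"
    using tri_cycle_append_swap[of "map tri (fan x P)" "map tri (fan y Q @ fan z R @ fan t S)"] cyc by simp
  then have long: "3 \<le> length P \<or> 3 \<le> length R" "3 \<le> length Q \<or> 3 \<le> length S"
    using four_runs_inner[OF assms] four_runs_inner[of y Q z R t S x P] len turns by simp_all
  \<comment> \<open>Each run is represented by one triangle, or by two if it has an inner rim vertex.\<close>
  define short where "short x P = [(x, hd P, last P)]" for x :: 'a and P :: "'a list"
  define mid where "mid x P = [(x, hd P, hd (tl P)), (x, hd (tl P), last P)]" for x :: 'a and P :: "'a list"
  have short: "liftable (ts @ short x P @ us) \<Longrightarrow> liftable (ts @ fan x P @ us)" if "2 \<le> length P" for x P ts us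
    unfolding short_def using liftable_fan[OF that] .
  have mid: "liftable (ts @ mid x P @ us) \<Longrightarrow> liftable (ts @ fan x P @ us)" if "3 \<le> length P" for x P ts us
    unfolding mid_def using liftable_fan_inner[OF that] .
  have four: "liftable (fan x P @ fan y Q @ fan z R @ fan t S)"
    if "liftable (a @ b @ c @ d)"
      "a = short x P \<or> a = mid x P \<and> 3 \<le> length P" "b = short y Q \<or> b = mid y Q \<and> 3 \<le> length Q"
      "c = short z R \<or> c = mid z R \<and> 3 \<le> length R" "d = short t S \<or> d = mid t S \<and> 3 \<le> length S" for a b c d
  proof -
    have "liftable ([] @ fan x P @ (b @ c @ d))"
      using that(1,2) short[OF len(1), of "[]"] mid[of P "[]"] by auto
    then have "liftable (fan x P @ fan y Q @ (c @ d))"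
      using that(3) short[OF len(2), of "fan x P"] mid[of Q "fan x P"] by auto
    then have "liftable ((fan x P @ fan y Q) @ fan z R @ d)"
      using that(4) short[OF len(3), of "fan x P @ fan y Q"] mid[of R "fan x P @ fan y Q"] by auto
    then have "liftable ((fan x P @ fan y Q @ fan z R) @ fan t S @ [])"
      using that(5) short[OF len(4), of "fan x P @ fan y Q @ fan z R" t "[]"]
        mid[of S "fan x P @ fan y Q @ fan z R" t "[]"] by auto
    then show ?thesis by simp
  qed
  have PQ: "liftable (mid x P @ mid y Q @ short z R @ short t S)"
    using liftable_K6_minus_P4[of "[]" _ x t "hd (tl P)" y "hd (tl Q)" z] turns
    by (simp add: mid_def short_def turn_def)
  have QR: "liftable (short x P @ mid y Q @ mid z R @ short t S)"
    using liftable_K6_minus_P4[of "mid y Q @ mid z R @ short t S" "short x P" y x "hd (tl Q)" z "hd (tl R)" t] turns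
    by (simp add: mid_def short_def turn_def)
  have RS: "liftable (short x P @ short y Q @ mid z R @ mid t S)"
    using liftable_K6_minus_P4[of "mid z R @ mid t S" "short x P @ short y Q" z y "hd (tl R)" t "hd (tl S)" x] turns
    by (simp add: mid_def short_def turn_def)
  have SP: "liftable (mid x P @ short y Q @ short z R @ mid t S)"
    using liftable_K6_minus_P4[of "mid t S" "mid x P @ short y Q @ short z R" t z "hd (tl S)" x "hd (tl P)" y] turns
    by (simp add: mid_def short_def turn_def)
  show ?thesis using long four[OF PQ] four[OF QR] four[OF RS] four[OF SP] by blast
qed

text \<open>Shortened to one triangle each, the runs form the strip of \<open>C\<^sub>k\<^sup>2\<close>, where the cycle passes through the apexes in
  their order.\<close>

lemma liftable_many_runs:
  assumes "5 \<le> length Rs" "successively turn (Rs @ [hd Rs])" "\<forall>(x, P)\<in>set Rs. 2 \<le> length P"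
  shows "liftable (strip_of_runs Rs)"
proof -
  let ?k = "length Rs" and ?X = "\<lambda>j. fst (Rs ! j)"
  have ne: "Rs \<noteq> []" using assms(1) by auto
  have turn: "turn (Rs ! i) (Rs ! (Suc i mod ?k))" if "i < ?k" for i
    using assms(2) that unfolding successively_closed_iff[OF ne] by blast
  have "map (\<lambda>(x, P). (x, hd P, last P)) Rs = map (relabel ?X) (square_strip ?k)"
  proof (rule nth_equalityI)
    fix i assume "i < length (map (\<lambda>(x, P). (x, hd P, last P)) Rs)"
    then have i: "i < ?k" by simp
    let ?p = "(i + ?k - 1) mod ?k"
    have "Suc ?p mod ?k = i" "?p < ?k" using i by (cases i; simp add: mod_Suc)+
    then have "turn (Rs ! ?p) (Rs ! i)" using turn[of ?p] by simp
    then show "map (\<lambda>(x, P). (x, hd P, last P)) Rs ! i = map (relabel ?X) (square_strip ?k) ! i"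
      using turn[OF i] i by (simp add: square_strip_def turn_def split_beta)
  qed (simp add: square_strip_def)
  then have "liftable ([] @ map (\<lambda>(x, P). (x, hd P, last P)) Rs @ [])"
    using liftableI[OF realises_square_strip[OF assms(1)], of ?X] by simp
  then have "liftable ([] @ strip_of_runs Rs @ [])" by (rule liftable_runs[OF assms(3)])
  then show ?thesis by simp
qed

text \<open>Starting right after a turn ensures that no run is cut in two by the ends of the list.\<close>

lemma liftable_turning_strip:
  assumes closed: "closed_strip D" and cyc: "tri_cycle (map tri D)" and len: "4 \<le> length D"
    and "fst (last D) \<noteq> fst (hd D)"
  shows "liftable D"
proof -
  have D: "D \<noteq> []" using len by auto
  have link: "successively (\<lambda>d d'. leave d = entry d') D" "leave (last D) = entry (hd D)"
    using closed D by (auto simp: closed_strip_def successively_append_iff)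
  obtain Rs where Rs: "Rs \<noteq> []" "D = strip_of_runs Rs" "successively turn Rs"
    and long: "\<forall>(x, P)\<in>set Rs. 2 \<le> length P"
    and ends: "fst (hd Rs) = fst (hd D)" "hd (snd (hd Rs)) = fst (snd (hd D))"
      "fst (last Rs) = fst (last D)" "last (snd (last Rs)) = snd (snd (last D))"
    using runs_exist[OF D link(1)] by blast
  have "turn (last Rs) (hd Rs)"
    using link(2) assms(4) ends by (cases "last D"; cases "hd D") (auto simp: turn_def doubleton_eq_iff)
  then have turns: "successively turn (Rs @ [hd Rs])"
    using Rs(1,3) by (simp add: successively_append_iff)
  consider "length Rs = 1" | "length Rs = 2" | "length Rs = 3" | "length Rs = 4" | "5 \<le> length Rs"
    using Rs(1) by (cases "length Rs") (auto, linarith)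
  then show ?thesis
  proof cases
    case 1
    then have "last Rs = hd Rs" by (cases Rs) auto
    then show ?thesis using ends assms(4) by simp
  next
    case 2
    then obtain x P y Q where "Rs = [(x, P), (y, Q)]"
      by (auto simp: length_Suc_conv numeral_eq_Suc)
    then show ?thesis using two_runs_impossible[of x P y Q] turns long cyc len Rs(2)
      by (simp add: strip_of_runs_def)
  next
    case 3
    then obtain x P y Q z R where "Rs = [(x, P), (y, Q), (z, R)]"
      by (auto simp: length_Suc_conv numeral_eq_Suc)
    then show ?thesis using liftable_three_runs[of x P y Q z R] turns long cyc len Rs(2)
      by (simp add: strip_of_runs_def)
  next
    case 4
    then obtain x P y Q z R t S where "Rs = [(x, P), (y, Q), (z, R), (t, S)]"
      by (auto simp: length_Suc_conv numeral_eq_Suc)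
    then show ?thesis using liftable_four_runs[of x P y Q z R t S] turns long cyc Rs(2)
      by (simp add: strip_of_runs_def)
  next
    case 5
    then show ?thesis using liftable_many_runs turns long Rs(2) by simp
  qed
qed

section \<open>From a cycle of triangles to a strip\<close>

lemma two_sides_of_triangle:
  assumes "card T = 3" "card X = 2" "card Y = 2" "X \<subseteq> T" "Y \<subseteq> T" "X \<noteq> Y"
  shows "\<exists>d. tri d = T \<and> entry d = X \<and> leave d = Y"
proof -
  have fin: "finite T" "finite X" "finite Y" using assms by (auto intro: card_ge_0_finite)
  have "card (X \<inter> Y) = 1"
  proof -
    have "card (X \<union> Y) \<le> 3" using assms fin by (metis card_mono Un_least)
    then have "1 \<le> card (X \<inter> Y)" using card_Un_Int[OF fin(2,3)] assms by simp
    moreover have "card (X \<inter> Y) < 2"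
    proof (rule ccontr)
      assume "\<not> card (X \<inter> Y) < 2"
      then have "X \<inter> Y = X" "X \<inter> Y = Y"
        using fin assms(2,3) by (intro card_seteq; simp)+
      then show False using assms(6) by simp
    qed
    ultimately show ?thesis by simp
  qed
  then obtain x where x: "X \<inter> Y = {x}" by (auto simp: card_1_singleton_iff)
  then have "x \<in> X" "x \<in> Y" by auto
  then have "card (X - {x}) = 1" "card (Y - {x}) = 1" using assms(2,3) by (simp_all add: card_Diff_singleton)
  then obtain u v where "X - {x} = {u}" "Y - {x} = {v}" by (auto simp: card_1_singleton_iff)
  then have uv: "X = {x, u}" "Y = {x, v}" "u \<noteq> v" "x \<noteq> u" "x \<noteq> v" using x by auto
  then have "T = {x, u, v}" using assms(1,4,5) fin by (intro card_seteq[symmetric]) auto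
  then show ?thesis using uv by (intro exI[of _ "(x, u, v)"]) simp
qed

lemma distinct_3_sets_inter:
  assumes "card S = 3" "card T = 3" "S \<noteq> T" "2 \<le> card (S \<inter> T)"
  shows "card (S \<inter> T) = 2"
proof (rule ccontr)
  have fin: "finite S" "finite T" using assms by (auto intro: card_ge_0_finite)
  assume "card (S \<inter> T) \<noteq> 2"
  then have "3 \<le> card (S \<inter> T)" using assms by simp
  then have "S \<inter> T = S" using fin assms(1) by (intro card_seteq) auto
  then show False using card_3_sets_eq assms by blast
qed

text \<open>A triangle shares different edges with its predecessor and its successor, as otherwise the common edge would lie in
  three triangles. Two edges of a triangle meet in its apex.\<close>

lemma tri_cycle_closed_strip:
  assumes "tri_cycle c" "4 \<le> length c"
  obtains D where "closed_strip D" "map tri D = c"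
proof -
  let ?n = "length c"
  define p where "p i = (i + ?n - 1) mod ?n" for i
  define s where "s i = Suc i mod ?n" for i
  have sp: "s i < ?n" "p i < ?n" "s (p i) = i" "p (s i) = i" "s i \<noteq> i" "p i \<noteq> i" "s i \<noteq> p i"
    if "i < ?n" for i
  proof -
    have s_if: "s j = (if Suc j = ?n then 0 else Suc j)" if "j < ?n" for j
      using that by (auto simp: s_def)
    have p_if: "p j = (if j = 0 then ?n - 1 else j - 1)" if "j < ?n" for j
      using that by (cases j) (auto simp: p_def)
    have pos: "0 < ?n" using assms(2) by linarith
    show "s i < ?n" "p i < ?n" "s (p i) = i" "p (s i) = i" "s i \<noteq> i" "p i \<noteq> i" "s i \<noteq> p i"
      using that assms(2) p_if[of 0, OF pos] s_if[of "i - 1"] by (auto simp: s_if p_if split: if_splits)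
  qed
  have c3: "card (c ! i) = 3" if "i < ?n" for i using assms(1) that by (auto simp: tri_cycle_def)
  have dis: "c ! i \<noteq> c ! j" if "i < ?n" "j < ?n" "i \<noteq> j" for i j
    using assms(1) that by (auto simp: tri_cycle_def nth_eq_iff_index_eq)
  have edge: "card (c ! i \<inter> c ! s i) = 2" if "i < ?n" for i
  proof -
    have "2 \<le> card (c ! i \<inter> c ! s i)"
      using assms(1) that sp[OF that] by (auto simp: tri_cycle_def s_def)
    then show ?thesis using distinct_3_sets_inter c3 dis that sp[OF that] by metis
  qed
  have "\<exists>d. tri d = c ! i \<and> entry d = c ! p i \<inter> c ! i \<and> leave d = c ! i \<inter> c ! s i" if i: "i < ?n" for i
  proof (rule two_sides_of_triangle)
    show "card (c ! p i \<inter> c ! i) = 2" using edge[of "p i"] sp[OF i] by simp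
    show "c ! p i \<inter> c ! i \<noteq> c ! i \<inter> c ! s i"
    proof
      assume eq: "c ! p i \<inter> c ! i = c ! i \<inter> c ! s i"
      obtain a b where ab: "c ! i \<inter> c ! s i = {a, b}" "a \<noteq> b" using edge[OF i] by (auto simp: card_2_iff)
      have sub: "{a, b} \<subseteq> c ! p i" "{a, b} \<subseteq> c ! i" "{a, b} \<subseteq> c ! s i"
        using equalityD2[OF ab(1)] equalityD2[OF trans[OF eq ab(1)]] by blast+
      have dis3: "distinct [c ! p i, c ! i, c ! s i]"
        using dis[of "p i" i] dis[of "p i" "s i"] dis[of i "s i"] sp[OF i] i by auto
      have "{c ! p i, c ! i, c ! s i} \<subseteq> set c" using sp[OF i] i by simp
      then show False by (rule tri_cycle_common_edge[OF assms _ dis3 ab(2) sub])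
    qed
  qed (use i edge c3 in auto)
  then have "\<forall>i. \<exists>d. i < ?n \<longrightarrow> tri d = c ! i \<and> entry d = c ! p i \<inter> c ! i \<and> leave d = c ! i \<inter> c ! s i"
    by blast
  from choice[OF this] obtain d where d: "\<And>i. i < ?n \<Longrightarrow> tri (d i) = c ! i \<and>
      entry (d i) = c ! p i \<inter> c ! i \<and> leave (d i) = c ! i \<inter> c ! s i"
    by blast
  let ?D = "map d [0..<?n]"
  have ne: "?D \<noteq> []" using assms(2) by auto
  have "closed_strip ?D"
    unfolding closed_strip_def successively_closed_iff[OF ne]
    using ne d sp by (simp flip: s_def)
  moreover have "map tri ?D = c" using d by (intro nth_equalityI) auto
  ultimately show ?thesis using that by blast
qed

section \<open>Wheels\<close>

lemma edges_wheel: "edges (wheel n) = {{i, Suc i mod n} | i. i < n} \<union> {{n, i} | i. i < n}"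
proof -
  have "{e. e \<subseteq> {n} \<and> card e = 2} = {}" by (auto simp: subset_singleton_iff)
  then show ?thesis by (auto simp: wheel_def graph_join_def complete_graph_def cycle_graph_def)
qed

lemma verts_wheel: "verts (wheel n) = {..n}"
  by (auto simp: wheel_def graph_join_def complete_graph_def cycle_graph_def)

lemma simple_graph_wheel: "3 \<le> n \<Longrightarrow> simple_graph (wheel n)"
  unfolding simple_graph_def edges_wheel verts_wheel
  by (auto simp: card_insert_if mod_Suc)

lemma tri_cycle_wheel:
  assumes "4 \<le> n"
  defines "c \<equiv> map (\<lambda>i. {n, i, Suc i mod n}) [0..<n]"
  shows "tri_cycle c" "set c \<subseteq> triangles (wheel n)" "length c = n"
proof -
  have s: "Suc i mod n < n" "Suc i mod n \<noteq> n" "Suc i mod n \<noteq> i" "Suc (Suc i mod n) mod n \<noteq> i"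
    if "i < n" for i
    using that assms(1) by (auto simp: mod_Suc)
  show len: "length c = n" by (simp add: c_def)
  have shared: "2 \<le> card ({n, i, Suc i mod n} \<inter> {n, j, Suc j mod n}) \<longleftrightarrow> j = Suc i mod n \<or> i = Suc j mod n"
    if ij: "i < n" "j < n" "i \<noteq> j" for i j
  proof
    assume "2 \<le> card ({n, i, Suc i mod n} \<inter> {n, j, Suc j mod n})"
    then obtain a b where "a \<noteq> b" "a \<in> {n, i, Suc i mod n} \<inter> {n, j, Suc j mod n}"
      "b \<in> {n, i, Suc i mod n} \<inter> {n, j, Suc j mod n}"
      by (auto simp: two_le_card_iff)
    then have "\<exists>a. a \<in> {i, Suc i mod n} \<and> a \<in> {j, Suc j mod n}"
      using s(2)[OF ij(1)] s(2)[OF ij(2)] ij by (cases "a = n") auto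
    then show "j = Suc i mod n \<or> i = Suc j mod n"
      using Suc_mod_inj[of i n j] ij s(2) by auto
  next
    assume "j = Suc i mod n \<or> i = Suc j mod n"
    then show "2 \<le> card ({n, i, Suc i mod n} \<inter> {n, j, Suc j mod n})"
    proof
      assume "j = Suc i mod n"
      then show ?thesis using ij s(2)[OF ij(1)] by (intro two_le_cardI[of _ n j]) auto
    next
      assume "i = Suc j mod n"
      then show ?thesis using ij s(2)[OF ij(2)] by (intro two_le_cardI[of _ n i]) auto
    qed
  qed
  have "i = j" if eq: "{n, i, Suc i mod n} = {n, j, Suc j mod n}" and ij: "i < n" "j < n" for i j
  proof (rule ccontr)
    assume "i \<noteq> j"
    have "i \<in> {n, j, Suc j mod n}" "j \<in> {n, i, Suc i mod n}" using eq by blast+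
    then have "i = Suc j mod n" "j = Suc i mod n" using ij \<open>i \<noteq> j\<close> by auto
    then show False using s(4)[OF ij(1)] by simp
  qed
  then have "distinct c" by (auto simp: c_def distinct_map inj_on_def)
  moreover have "card {n, i, Suc i mod n} = 3" if "i < n" for i
    using s[OF that] that by (auto simp: card_insert_if)
  ultimately show "tri_cycle c"
    using shared assms(1) by (auto simp: tri_cycle_def c_def)
  show "set c \<subseteq> triangles (wheel n)"
  proof
    fix T assume "T \<in> set c"
    then obtain i where i: "i < n" "T = {n, i, Suc i mod n}" by (auto simp: c_def)
    have "{n, i} \<in> edges (wheel n)" "{n, Suc i mod n} \<in> edges (wheel n)" "{i, Suc i mod n} \<in> edges (wheel n)"
      using s[OF i(1)] i(1) unfolding edges_wheel by blast+
    then show "T \<in> triangles (wheel n)"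
      using s[OF i(1)] i tri_in_triangles[of "(n, i, Suc i mod n)" "wheel n"]
      by (auto simp: verts_wheel card_insert_if)
  qed
qed

lemma sides_subset_edges:
  "tri d \<in> triangles G \<Longrightarrow> sides d \<subseteq> edges G"
proof -
  assume T: "tri d \<in> triangles G"
  obtain x u v where d: "d = (x, u, v)" by (cases d)
  then have "x \<noteq> u" "x \<noteq> v" "u \<noteq> v"
    using triangles_card[OF T] by (auto simp: card_insert_if split: if_splits)
  then show ?thesis using triangle_edge[OF T] by (auto simp: d)
qed

text \<open>The strip consists of the triangles \<open>x, u\<^sub>i, u\<^sub>i\<^sub>+\<^sub>1\<close>. If two of the rim vertices coincided, the spoke to them
  would lie in more than two triangles.\<close>

lemma wheel_copy_from_strip:
  assumes closed: "closed_strip D" and cyc: "tri_cycle (map tri D)" and len: "4 \<le> length D"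
    and tris: "set (map tri D) \<subseteq> triangles G" and hub: "\<forall>d\<in>set D. fst d = x"
  shows "contains_copy G (wheel (length D))"
proof -
  let ?n = "length D"
  define s where "s i = Suc i mod ?n" for i
  define u where "u i = fst (snd (D ! i))" for i
  have D: "D \<noteq> []" using len by auto
  have s_lt: "s i < ?n" for i using D by (simp add: s_def)
  have T: "{x, u i, u (s i)} = tri (D ! i)" "x \<noteq> u i" "u i \<noteq> u (s i)" if i: "i < ?n" for i
  proof -
    obtain v v' where d: "D ! i = (x, u i, v)" "D ! s i = (x, u (s i), v')"
      using hub i s_lt[of i] by (metis nth_mem prod.collapse u_def)
    have "leave (D ! i) = entry (D ! s i)"
      using closed i unfolding closed_strip_def successively_closed_iff[OF D] by (simp add: s_def)
    then have v: "v = u (s i)" using d by (auto simp: doubleton_eq_iff)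
    then show T: "{x, u i, u (s i)} = tri (D ! i)" using d by simp
    have "card (tri (D ! i)) = 3" using cyc i by (simp add: tri_cycle_def)
    then show "x \<noteq> u i" "u i \<noteq> u (s i)" unfolding T[symmetric] by (auto simp: card_insert_if split: if_splits)
  qed
  have inG: "tri (D ! i) \<in> triangles G" if "i < ?n" for i using tris that by auto
  have dis: "tri (D ! i) \<noteq> tri (D ! j)" if "i < ?n" "j < ?n" "i \<noteq> j" for i j
    using nth_eq_iff_index_eq[of "map tri D" i j] cyc that by (simp add: tri_cycle_def)
  have inj: "i = j" if ij: "i < ?n" "j < ?n" "u i = u j" for i j
  proof (rule ccontr)
    assume ne: "i \<noteq> j"
    have pre: "\<exists>p<?n. s p = q \<and> p \<noteq> q" if "q < ?n" for q
      using that len by (intro exI[of _ "if q = 0 then ?n - 1 else q - 1"]) (auto simp: s_def)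
    obtain p where p: "p < ?n" "s p = i" "p \<noteq> i" using pre[OF ij(1)] by blast
    obtain q where q: "q < ?n" "s q = j" "q \<noteq> j" using pre[OF ij(2)] by blast
    have no: "\<not> distinct [k, l, m]" if "k < ?n" "l < ?n" "m < ?n" "{x, u i} \<subseteq> tri (D ! k)"
      "{x, u i} \<subseteq> tri (D ! l)" "{x, u i} \<subseteq> tri (D ! m)" for k l m
    proof
      assume "distinct [k, l, m]"
      then have dis3: "distinct [tri (D ! k), tri (D ! l), tri (D ! m)]" using dis that by simp
      have sub: "{tri (D ! k), tri (D ! l), tri (D ! m)} \<subseteq> set (map tri D)" using that by simp
      have "4 \<le> length (map tri D)" using len by simp
      then show False
        by (rule tri_cycle_common_edge[OF cyc _ sub dis3 T(2)[OF ij(1)] that(4-6)])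
    qed
    \<comment> \<open>Each of the spokes \<open>u i\<close> and \<open>u j\<close> lies in two consecutive triangles; three of these four are different.\<close>
    have "{x, u i} \<subseteq> tri (D ! i)" "{x, u i} \<subseteq> tri (D ! p)" "{x, u i} \<subseteq> tri (D ! j)" "{x, u i} \<subseteq> tri (D ! q)"
      using T(1)[OF ij(1)] T(1)[OF ij(2)] T(1)[OF p(1)] T(1)[OF q(1)] p q ij(3) by auto
    then have "p = j" "q = i" using no[of i p j] no[of i q j] p q ij ne by auto
    then have "s j = i" "s i = j" using p q by simp_all
    then show False using ij len by (auto simp: s_def mod_Suc split: if_splits)
  qed
  let ?f = "\<lambda>i. if i = ?n then x else u i"
  have "inj_on ?f (verts (wheel ?n))"
  proof (rule inj_onI)
    fix i j assume "i \<in> verts (wheel ?n)" "j \<in> verts (wheel ?n)" "?f i = ?f j"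
    then show "i = j" using T(2)[of i] T(2)[of j] inj[of i j]
      by (cases "i = ?n"; cases "j = ?n") (simp_all add: verts_wheel)
  qed
  moreover have "?f ` verts (wheel ?n) \<subseteq> verts G"
  proof -
    have "tri (D ! i) \<subseteq> verts G" if "i < ?n" for i using triangles_card[OF inG[OF that]] by simp
    then have "x \<in> verts G" "u i \<in> verts G" if "i < ?n" for i using T(1)[OF that] that by blast+
    then show ?thesis unfolding verts_wheel using D by force
  qed
  moreover have "(`) ?f ` edges (wheel ?n) \<subseteq> edges G"
  proof -
    have "{u i, u (s i)} \<in> edges G" "{x, u i} \<in> edges G" if "i < ?n" for i
    proof -
      have "u i \<in> tri (D ! i)" "u (s i) \<in> tri (D ! i)" "x \<in> tri (D ! i)"
        using T(1)[OF that] by blast+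
      then show "{u i, u (s i)} \<in> edges G" "{x, u i} \<in> edges G"
        using triangle_edge[OF inG[OF that]] T(2,3)[OF that] by blast+
    qed
    moreover have "?f ` {i, Suc i mod ?n} = {u i, u (s i)}" "?f ` {?n, i} = {x, u i}" if "i < ?n" for i
      using that s_lt[of i] by (simp_all add: insert_commute flip: s_def)
    ultimately show ?thesis unfolding edges_wheel by (auto simp only: image_subset_iff)
  qed
  moreover have "3 \<le> ?n" using len by linarith
  ultimately show ?thesis by (rule contains_copyI[OF simple_graph_wheel, rotated])
qed

section \<open>From strips to subgraphs\<close>

text \<open>Two edges with the same image lie in triangles whose images share this image. These triangles are then equal or consecutive
  in both cycles; if they are consecutive, the image is the only common edge of the image triangles, and
  both edges are the common edge of the original triangles.\<close>

lemma relabel_edge_embedding: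
  assumes simple: "simple_graph H" and cover: "\<forall>e\<in>edges H. \<exists>T\<in>set c. e \<subseteq> T"
    and cyc: "tri_cycle c" "tri_cycle (map ((`) f) c)"
  shows "edge_embedding f H"
proof -
  have c3: "card T = 3" "card (f ` T) = 3" "finite T" if "T \<in> set c" for T
    using cyc that by (auto simp: tri_cycle_def intro: card_ge_0_finite)
  have inj: "inj_on f T" if "T \<in> set c" for T
    using c3[OF that] by (intro eq_card_imp_inj_on) auto
  have e2: "card e = 2" if "e \<in> edges H" for e using simple that by (auto simp: simple_graph_def)
  have fe2: "card (f ` e) = 2" if eH: "e \<in> edges H" for e
  proof -
    obtain T where T: "T \<in> set c" "e \<subseteq> T" using bspec[OF cover eH] by (elim bexE)
    show ?thesis using card_image[OF inj_on_subset[OF inj[OF T(1)] T(2)]] e2[OF eH] by simp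
  qed
  have "e = e'" if e: "e \<in> edges H" "e' \<in> edges H" "f ` e = f ` e'" for e e'
  proof -
    obtain S T where "S \<in> set c" "T \<in> set c" "e \<subseteq> S" "e' \<subseteq> T" using cover e by meson
    then obtain i j where ij: "i < length c" "j < length c" "e \<subseteq> c ! i" "e' \<subseteq> c ! j"
      by (auto simp: in_set_conv_nth)
    let ?S = "c ! i" and ?T = "c ! j"
    have ST: "?S \<in> set c" "?T \<in> set c" using ij by auto
    show ?thesis
    proof (cases "i = j")
      case True
      then show ?thesis using inj_on_image_eq_iff[OF inj[OF ST(1)]] ij e by auto
    next
      case False
      have fe: "f ` e \<subseteq> f ` ?S \<inter> f ` ?T" using ij e(3) by blast
      have "finite (f ` ?S \<inter> f ` ?T)" using c3 ST by auto
      then have "2 \<le> card (f ` ?S \<inter> f ` ?T)" using card_mono[OF _ fe] fe2[OF e(1)] by simp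
      moreover have "f ` ?S \<noteq> f ` ?T"
        using nth_eq_iff_index_eq[of "map ((`) f) c" i j] cyc(2) False ij by (simp add: tri_cycle_def)
      ultimately have two: "card (f ` ?S \<inter> f ` ?T) = 2" using distinct_3_sets_inter c3 ST by metis
      have "2 \<le> card (?S \<inter> ?T)"
        using \<open>2 \<le> card (f ` ?S \<inter> f ` ?T)\<close> cyc False ij by (auto simp: tri_cycle_def)
      then obtain d where d: "d \<subseteq> ?S \<inter> ?T" "card d = 2" by (meson obtain_subset_with_card_n)
      have "card (f ` d) = 2" using d inj[OF ST(1)] by (metis card_image inj_on_subset le_infE)
      then have "f ` d = f ` ?S \<inter> f ` ?T" using two d(1) \<open>finite (f ` ?S \<inter> f ` ?T)\<close>
        by (intro card_seteq) auto
      moreover have "f ` e = f ` ?S \<inter> f ` ?T" using two fe fe2[OF e(1)] \<open>finite (f ` ?S \<inter> f ` ?T)\<close>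
        by (intro card_seteq) auto
      ultimately have "f ` e = f ` d" "f ` e' = f ` d" using e(3) by simp_all
      then have "e = d" "e' = d"
        using inj_on_image_eq_iff[OF inj[OF ST(1)]] inj_on_image_eq_iff[OF inj[OF ST(2)]] ij d(1) by auto
      then show ?thesis by simp
    qed
  qed
  then show ?thesis using fe2 by (simp add: edge_embedding_def inj_on_def)
qed

lemma weakly_generated_copy_from_strip:
  assumes "liftable D" "tri_cycle (map tri D)" "set (map tri D) \<subseteq> triangles G"
  shows "\<exists>H c. weakly_generated H c \<and> contains_copy G H"
proof -
  obtain H D' f where r: "realises H D'" and D: "D = map (relabel f) D'"
    using assms(1) by (auto simp: liftable_def)
  have gen: "weakly_generated H (map tri D')" and V: "verts H = \<Union> (tri ` set D')"
    and E: "edges H = \<Union> (sides ` set D')" using r by (auto simp: realises_def)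
  note inv = weakly_generated_invariant[OF gen]
  have map: "map tri D = map ((`) f) (map tri D')" by (simp add: D tri_relabel)
  have "edge_embedding f H"
  proof (rule relabel_edge_embedding)
    show "\<forall>e\<in>edges H. \<exists>T\<in>set (map tri D'). e \<subseteq> T"
      unfolding E set_map using sides_subset_tri by blast
    show "tri_cycle (map ((`) f) (map tri D'))" using assms(2) by (simp only: map)
  qed (use inv in blast)+
  moreover have T: "tri (relabel f d) \<in> triangles G" if "d \<in> set D'" for d
    using assms(3) that by (auto simp: D)
  have "f ` verts H \<subseteq> verts G"
    using triangles_card[OF T] unfolding V tri_relabel by blast
  moreover have "(`) f ` edges H \<subseteq> edges G"
  proof (rule image_subsetI)
    fix e assume "e \<in> edges H"
    then obtain d where d: "d \<in> set D'" "e \<in> sides d" unfolding E by blast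
    have "f ` e \<in> sides (relabel f d)" using d(2) by (cases d) auto
    then show "f ` e \<in> edges G" using sides_subset_edges[OF T[OF d(1)]] by blast
  qed
  ultimately show ?thesis by (rule weakly_generated_copy_from_edge_embedding[OF gen])
qed

text \<open>Locates a turn in a strip whose apex is not constant.\<close>

lemma successively_split:
  "\<not> successively P D \<Longrightarrow> \<exists>A a b B. D = A @ [a, b] @ B \<and> \<not> P a b"
proof (induction D)
  case (Cons d D)
  show ?case
  proof (cases "successively P D")
    case True
    then obtain e E where "D = e # E" "\<not> P d e" using Cons.prems by (cases D) auto
    then show ?thesis by (intro exI[of _ "[]"]) auto
  next
    case False
    then obtain A a b B where "D = A @ [a, b] @ B" "\<not> P a b" using Cons.IH by blast
    then show ?thesis by (intro exI[of _ "d # A"]) auto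
  qed
qed simp

lemma successively_eq_hd:
  "successively (\<lambda>a b. f a = f b) xs \<Longrightarrow> \<forall>x\<in>set xs. f x = f (hd xs)"
proof (induction xs)
  case (Cons x xs)
  show ?case
  proof (cases "xs = []")
    case False
    then have "f x = f (hd xs)" "successively (\<lambda>a b. f a = f b) xs"
      using Cons.prems by (simp_all add: successively_Cons)
    then show ?thesis using bspec[OF Cons.IH] by (metis list.sel(1) set_ConsD)
  qed simp
qed simp

theorem corollary16:
  fixes G :: "'a ugraph"
  assumes "simple_graph G"
  shows "chordal (triangle_graph G) \<longleftrightarrow>
    \<not> ((\<exists>n\<ge>4. contains_copy G (wheel n)) \<or>
       (\<exists>n\<ge>5. contains_copy G (graph_square (cycle_graph n))) \<or>
       contains_copy G K6_minus_K3 \<or>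
       contains_copy G K6_minus_P4 \<or>
       (\<exists>H c. weakly_generated H c \<and> contains_copy G H))" (is "_ \<longleftrightarrow> \<not> ?forbidden")
proof -
  have "\<not> chordal (triangle_graph G)" if "weakly_generated H c" "contains_copy G H" for H c
    using weakly_generated_invariant[OF that(1)] contains_copy_not_chordal[OF assms _ that(2), of c]
    by auto
  moreover have "\<not> chordal (triangle_graph G)" if "4 \<le> n" "contains_copy G (wheel n)" for n
    using tri_cycle_wheel[OF that(1)] simple_graph_wheel[of n] that(1)
    by (intro contains_copy_not_chordal[OF assms _ that(2)]) auto
  moreover have "\<exists>c. weakly_generated (graph_square (cycle_graph n)) c" if "5 \<le> n" for n
    using realises_square_strip[OF that] by (auto simp: realises_def)
  moreover have "\<exists>c. weakly_generated K6_minus_K3 c" "\<exists>c. weakly_generated K6_minus_P4 c"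
    using realises_K6_minus_K3_strip realises_K6_minus_P4_strip[of "[]"] by (auto simp: realises_def)
  ultimately have easy: "?forbidden \<Longrightarrow> \<not> chordal (triangle_graph G)" by blast
  have "?forbidden" if cyclic: "\<not> chordal (triangle_graph G)"
  proof -
    obtain c where c: "tri_cycle c" "set c \<subseteq> triangles G" "4 \<le> length c"
      using cyclic unfolding chordal_def induced_cycle_triangle_graph_iff[OF assms] by blast
    obtain D where D: "closed_strip D" "map tri D = c" using tri_cycle_closed_strip[OF c(1,3)] .
    show ?thesis
    proof (cases "successively (\<lambda>d d'. fst d = fst d') D")
      case True
      then have hub: "\<forall>d\<in>set D. fst d = fst (hd D)" by (rule successively_eq_hd)
      have "4 \<le> length D" using c(3) unfolding D(2)[symmetric] by simp
      moreover have "contains_copy G (wheel (length D))"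
        by (rule wheel_copy_from_strip[OF D(1) _ _ _ hub])
          (use D(2) c \<open>4 \<le> length D\<close> in simp_all)
      ultimately show ?thesis by blast
    next
      case False
      then obtain A a b B where AB: "D = (A @ [a]) @ (b # B)" "fst a \<noteq> fst b"
        using successively_split[OF False] by auto
      \<comment> \<open>The cycle is rotated so that its list begins right after a turn.\<close>
      let ?D = "(b # B) @ (A @ [a])"
      have "closed_strip ?D" using closed_strip_append_swap D(1) unfolding AB(1) .
      moreover have cyc: "tri_cycle (map tri ?D)"
        using tri_cycle_append_swap[of "map tri (A @ [a])" "map tri (b # B)"] c(1) D(2) AB(1) by simp
      ultimately have "liftable ?D"
        using c(3) D(2) AB by (intro liftable_turning_strip) auto
      moreover have "set (map tri ?D) = set c" unfolding D(2)[symmetric] AB(1) by auto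
      then have "set (map tri ?D) \<subseteq> triangles G" using c(2) by (simp only:)
      ultimately show ?thesis using weakly_generated_copy_from_strip cyc by blast
    qed
  qed
  then show ?thesis using easy by blast
qed

end
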